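(* Let $q\in\mathbb{C}^*$ be not a root of unity, $j\in\frac12\mathbb{N}_+$ and $u\in\mathbb{C}^*$. Let $u_1/u_2=q^{-j-\frac12}$ and $u_2=uq^{\frac12}$ (so $u_1=uq^{-j}$). Let $\mathcal{E}^{(j+\frac12)}:\mathbb{C}^{2j+2}_u\to\mathbb{C}^2_{u_1}\otimes\mathbb{C}^{2j+1}_{u_2}$ be a linear map with scalar matrix entries $\mathcal{E}^{(j+\frac12)}_{a,b}$, $1\le a\le 4j+2$, $1\le b\le 2j+2$, in the bases fixed in the context, admitting a pseudo-inverse, i.e. a linear map $\mathcal{F}^{(j+\frac12)}:\mathbb{C}^2_{u_1}\otimes\mathbb{C}^{2j+1}_{u_2}\to\mathbb{C}^{2j+2}_u$ with $\mathcal{F}^{(j+\frac12)}\mathcal{E}^{(j+\frac12)}=\mathbb{I}_{2j+2}$ (the $(2j+2)\times(2j+2)$ identity matrix). Then $\mathcal{E}^{(j+\frac12)}$ is an $\mathcal{L}U_q\mathfrak{sl}_2$-intertwiner, i.e. $$\mathcal{E}^{(j+\frac12)}\,\pi_u^{j+\frac12}(x)=(\pi^{\frac12}_{uq^{-j}}\otimes\pi^j_{uq^{1/2}})(\Delta(x))\,\mathcal{E}^{(j+\frac12)}\qquad\text{for all }x\in\mathcal{L}U_q\mathfrak{sl}_2,$$ if and only if its entries are given by $$\mathcal{E}^{(j+\frac12)}_{1,1}=1,\qquad\mathcal{E}^{(j+\frac12)}_{1+n,1+n}=\prod_{p=0}^{n-1}\frac{B_{j,j-p}}{B_{j+\frac12,j+\frac12-p}},\qquad\mathcal{E}^{(j+\frac12)}_{2j+1+m,1+m}=[m]_q\frac{\mathcal{E}^{(j+\frac12)}_{m,m}}{B_{j+\frac12,j+\frac32-m}},$$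 where $n=1,2,\dots,2j$ and $m=1,2,\dots,2j+1$, and all the other entries are zero.
   Context: $[n]_q=\frac{q^n-q^{-n}}{q-q^{-1}}$, $[X,Y]_q=qXY-q^{-1}YX$, $[X,Y]=XY-YX$, $q^{1/2}$ a fixed square root, $A_{j,m}=\sqrt{[j-m]_q[j+m+1]_q}$, $B_{j,m}=\sqrt{[j+m]_q[j-m+1]_q}$ (so $A_{j,m}=B_{j,m+1}$). $U_q\mathfrak{sl}_2$: generators $E,F,K^{\pm1/2}$, with $K^{1/2}K^{-1/2}=K^{-1/2}K^{1/2}=1$, $K^{1/2}E=qEK^{1/2}$, $K^{1/2}F=q^{-1}FK^{1/2}$, $[E,F]=\frac{K-K^{-1}}{q-q^{-1}}$. Quantum loop algebra $\mathcal{L}U_q\mathfrak{sl}_2$: generators $E_i,F_i,K_i^{\pm1/2}$, $i=0,1$, with $a_{ii}=2$, $a_{01}=a_{10}=-2$, $K_i^{1/2}K_i^{-1/2}=K_i^{-1/2}K_i^{1/2}=1$, $K_i^{1/2}E_k=q^{a_{ik}/2}E_kK_i^{1/2}$, $K_i^{1/2}F_k=q^{-a_{ik}/2}F_kK_i^{1/2}$, $[E_i,F_k]=\delta_{ik}\frac{K_i-K_i^{-1}}{q-q^{-1}}$, $K_0^{1/2}K_1^{1/2}=K_1^{1/2}K_0^{1/2}=1$, $[E_i,[E_i,[E_i,E_k]_q]_{q^{-1}}]=0=[F_i,[F_i,[F_i,F_k]_q]_{q^{-1}}]$ ($i\neq k$), and coproduct $\Delta(E_i)=E_i\otimes K_i^{1/2}+K_i^{-1/2}\otimes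 E_i$, $\Delta(F_i)=F_i\otimes K_i^{1/2}+K_i^{-1/2}\otimes F_i$, $\Delta(K_i^{\pm1/2})=K_i^{\pm1/2}\otimes K_i^{\pm1/2}$. $\pi^j$ is the representation of $U_q\mathfrak{sl}_2$ on $\mathbb{C}^{2j+1}$ with basis $|j,m\rangle$, $m=j,j-1,\dots,-j$: $E|j,m\rangle=A_{j,m}|j,m+1\rangle$, $F|j,m\rangle=B_{j,m}|j,m-1\rangle$, $K^{\pm1/2}|j,m\rangle=q^{\pm m}|j,m\rangle$. For $u\in\mathbb{C}^*$, $\pi^j_u=\pi^j\circ\mathsf{ev}_u$ where $\mathsf{ev}_u:\mathcal{L}U_q\mathfrak{sl}_2\to U_q\mathfrak{sl}_2$ is the algebra map $E_0\mapsto u^{-1}F$, $F_0\mapsto uE$, $K_0^{1/2}\mapsto K^{-1/2}$, $E_1\mapsto u^{-1}E$, $F_1\mapsto uF$, $K_1^{1/2}\mapsto K^{1/2}$; the corresponding module is denoted $\mathbb{C}^{2j+1}_u$. Bases: source $|j+\frac12,m\rangle$ with $m=j+\frac12,j-\frac12,\dots,-j-\frac12$; target $|\uparrow\rangle\otimes|j,j\rangle,\dots,|\uparrow\rangle\otimes|j,-j\rangle,|\downarrow\rangle\otimes|j,j\rangle,\dots,|\downarrow\rangle\otimes|j,-j\rangle$ (in these orders), where $|\uparrow\rangle=|\frac12,\frac12\rangle$, $|\downarrow\rangle=|\frac12,-\frac12\rangle$.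
   Formalization: As stated, the "only if" fails for 2𝓔 (pseudo-inverse 𝓕/2), an intertwiner with (1,1) entry 2; proved instead: 𝓔 is an intertwiner iff some nonzero multiple of it has the listed entries, and, if 𝓔_{1,1}=1, iff 𝓔 itself has them. *)

theory Defs
  imports
    Complex_Main
    "HOL-Library.Poly_Mapping"
    "HOL-Library.Product_Plus"
    "HOL-Algebra.QuotRing"
    "Jordan_Normal_Form.Matrix"
begin

section \<open>Presented complex algebras\<close>

text \<open>
  The monoid algebra of a monoid \<open>M\<close> over the complex numbers is the type of finitely supported
  functions on \<open>M\<close>, whose product is convolution. The library writes the monoid
  operation additively, also when it is not commutative; so concatenation of words is \<open>+\<close> below.
  The monoid algebra of the free monoid is the free associative unital algebra, and that of a
  product of two free monoids is the tensor product of two free algebras.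
\<close>

datatype 'g free_monoid = Letters (letters: "'g list")

instantiation free_monoid :: (type) monoid_add
begin

definition zero_free_monoid :: "'a free_monoid"
  where "0 = Letters []"

definition plus_free_monoid :: "'a free_monoid \<Rightarrow> 'a free_monoid \<Rightarrow> 'a free_monoid"
  where "v + w = Letters (letters v @ letters w)"

instance
  by standard (simp_all add: zero_free_monoid_def plus_free_monoid_def)

end

type_synonym 'm monoid_alg = "'m \<Rightarrow>\<^sub>0 complex"
type_synonym 'g free_alg = "'g free_monoid monoid_alg"

definition gen :: "'g \<Rightarrow> 'g free_alg"
  where "gen g = Poly_Mapping.single (Letters [g]) 1"

definition smul :: "complex \<Rightarrow> 'm::monoid_add monoid_alg \<Rightarrow> 'm monoid_alg"
  where "smul c x = Poly_Mapping.single 0 c * x"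

definition tens :: "'m monoid_alg \<Rightarrow> 'n monoid_alg \<Rightarrow> ('m \<times> 'n) monoid_alg"  (infixl "\<otimes>\<^sub>a" 70)
  where "x \<otimes>\<^sub>a y =
    (\<Sum>v\<in>Poly_Mapping.keys x. \<Sum>w\<in>Poly_Mapping.keys y.
       Poly_Mapping.single (v, w) (Poly_Mapping.lookup x v * Poly_Mapping.lookup y w))"

text \<open>The unital algebra homomorphism out of a free algebra with prescribed values on the generators.\<close>

definition free_hom :: "('g \<Rightarrow> 'm::monoid_add monoid_alg) \<Rightarrow> 'g free_alg \<Rightarrow> 'm monoid_alg"
  where "free_hom \<phi> x =
    (\<Sum>w\<in>Poly_Mapping.keys x. smul (Poly_Mapping.lookup x w) (prod_list (map \<phi> (letters w))))"

text \<open>The linear extension of a matrix-valued function on the monoid.\<close>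

definition mat_lin_ext :: "nat \<Rightarrow> ('m \<Rightarrow> complex mat) \<Rightarrow> 'm monoid_alg \<Rightarrow> complex mat"
  where "mat_lin_ext n \<rho> x =
    mat n n (\<lambda>ab. \<Sum>w\<in>Poly_Mapping.keys x. Poly_Mapping.lookup x w * \<rho> w $$ ab)"

definition free_rep :: "nat \<Rightarrow> ('g \<Rightarrow> complex mat) \<Rightarrow> 'g free_alg \<Rightarrow> complex mat"
  where "free_rep n \<rho> = mat_lin_ext n (\<lambda>w. foldr (\<lambda>g M. \<rho> g * M) (letters w) (1\<^sub>m n))"

definition monoid_alg_ring :: "'m::monoid_add monoid_alg ring"
  where "monoid_alg_ring = \<lparr>carrier = UNIV, monoid.mult = (*), one = 1, zero = 0, add = (+)\<rparr>"

text \<open>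
  The quotient by the two-sided ideal generated by a set of relators (elements set equal to zero);
  its elements are cosets. This ideal is closed under \<open>smul\<close>, since \<open>smul c\<close> is multiplication by
  an element of the algebra, so the quotient ring is a complex algebra.
\<close>

definition presented :: "'m::monoid_add monoid_alg set \<Rightarrow> 'm monoid_alg set ring"
  where "presented R = monoid_alg_ring Quot (Idl\<^bsub>monoid_alg_ring\<^esub> R)"

definition cls :: "'m::monoid_add monoid_alg set \<Rightarrow> 'm monoid_alg \<Rightarrow> 'm monoid_alg set"
  where "cls R x = (Idl\<^bsub>monoid_alg_ring\<^esub> R) +>\<^bsub>monoid_alg_ring\<^esub> x"

text \<open>
  The map induced on cosets by a map on representatives. It is only used for maps which are
  constant on cosets, so that the choice of the representative is irrelevant.
\<close>

definition induced :: "('a \<Rightarrow> 'b) \<Rightarrow> 'a set \<Rightarrow> 'b"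
  where "induced f X = f (SOME x. x \<in> X)"

text \<open>
  For algebras \<open>A\<close>, \<open>B\<close> presented by \<open>R\<close>, \<open>S\<close>, the tensor product of \<open>A\<close> and \<open>B\<close> is the quotient
  of the tensor product of the two free algebras by the ideal generated by these elements.
\<close>

definition tensor_rels ::
  "'m::monoid_add monoid_alg set \<Rightarrow> 'n::monoid_add monoid_alg set \<Rightarrow> ('m \<times> 'n) monoid_alg set"
  where "tensor_rels R S = (\<lambda>r. r \<otimes>\<^sub>a 1) ` R \<union> (\<lambda>r. 1 \<otimes>\<^sub>a r) ` S"


section \<open>The quantum algebras\<close>

definition comm :: "'a::ring \<Rightarrow> 'a \<Rightarrow> 'a"
  where "comm x y = x * y - y * x"

definition qcomm :: "complex \<Rightarrow> 'm::monoid_add monoid_alg \<Rightarrow> 'm monoid_alg \<Rightarrow> 'm monoid_alg"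
  where "qcomm q x y = smul q (x * y) - smul (inverse q) (y * x)"

text \<open>
  The generators \<open>HK\<close>, \<open>HKinv\<close> (and \<open>LK i\<close>, \<open>LKinv i\<close> below) stand for the half powers
  \<open>K\<^sup>1\<^sup>/\<^sup>2\<close>, \<open>K\<^sup>-\<^sup>1\<^sup>/\<^sup>2\<close>.
\<close>

datatype sl2_gen = HE | HF | HK | HKinv

definition Uq_rels :: "complex \<Rightarrow> sl2_gen free_alg set"
  where "Uq_rels q =
    (let E = gen HE; F = gen HF; K = gen HK; K' = gen HKinv in
     {K * K' - 1,
      K' * K - 1,
      K * E - smul q (E * K),
      K * F - smul (inverse q) (F * K),
      comm E F - smul (1 / (q - inverse q)) (K * K - K' * K')})"

datatype node = N0 | N1

datatype loop_gen = LE node | LF node | LK node | LKinv node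

definition cartan :: "node \<Rightarrow> node \<Rightarrow> int"
  where "cartan i k = (if i = k then 2 else -2)"

definition LUq_rels :: "complex \<Rightarrow> loop_gen free_alg set"
  where "LUq_rels q =
    (let E = (\<lambda>i. gen (LE i)); F = (\<lambda>i. gen (LF i));
         K = (\<lambda>i. gen (LK i)); K' = (\<lambda>i. gen (LKinv i)) in
     {K i * K' i - 1 | i. True} \<union>
     {K' i * K i - 1 | i. True} \<union>
     {K i * E k - smul (q powi (cartan i k div 2)) (E k * K i) | i k. True} \<union>
     {K i * F k - smul (q powi (- (cartan i k div 2))) (F k * K i) | i k. True} \<union>
     {comm (E i) (F k) -
        (if i = k then smul (1 / (q - inverse q)) (K i * K i - K' i * K' i) else 0) | i k. True} \<union>
     {K N0 * K N1 - 1, K N1 * K N0 - 1} \<union>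
     {comm (E i) (qcomm (inverse q) (E i) (qcomm q (E i) (E k))) | i k. i \<noteq> k} \<union>
     {comm (F i) (qcomm (inverse q) (F i) (qcomm q (F i) (F k))) | i k. i \<noteq> k})"

definition Uq :: "complex \<Rightarrow> sl2_gen free_alg set ring"
  where "Uq q = presented (Uq_rels q)"

definition LUq :: "complex \<Rightarrow> loop_gen free_alg set ring"
  where "LUq q = presented (LUq_rels q)"

definition LUq_tensor_rels ::
  "complex \<Rightarrow> (loop_gen free_monoid \<times> loop_gen free_monoid) monoid_alg set"
  where "LUq_tensor_rels q = tensor_rels (LUq_rels q) (LUq_rels q)"

definition LUq_tensor ::
  "complex \<Rightarrow> (loop_gen free_monoid \<times> loop_gen free_monoid) monoid_alg set ring"
  where "LUq_tensor q = presented (LUq_tensor_rels q)"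

fun coproduct_gen :: "loop_gen \<Rightarrow> (loop_gen free_monoid \<times> loop_gen free_monoid) monoid_alg"
  where
    "coproduct_gen (LE i) = gen (LE i) \<otimes>\<^sub>a gen (LK i) + gen (LKinv i) \<otimes>\<^sub>a gen (LE i)"
  | "coproduct_gen (LF i) = gen (LF i) \<otimes>\<^sub>a gen (LK i) + gen (LKinv i) \<otimes>\<^sub>a gen (LF i)"
  | "coproduct_gen (LK i) = gen (LK i) \<otimes>\<^sub>a gen (LK i)"
  | "coproduct_gen (LKinv i) = gen (LKinv i) \<otimes>\<^sub>a gen (LKinv i)"

text \<open>The coproduct, as a map from \<open>LUq q\<close> to \<open>LUq_tensor q\<close>.\<close>

definition coproduct ::
  "complex \<Rightarrow> loop_gen free_alg set \<Rightarrow> (loop_gen free_monoid \<times> loop_gen free_monoid) monoid_alg set"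
  where "coproduct q = induced (\<lambda>x. cls (LUq_tensor_rels q) (free_hom coproduct_gen x))"

fun ev_gen :: "complex \<Rightarrow> loop_gen \<Rightarrow> sl2_gen free_alg"
  where
    "ev_gen u (LE N0) = smul (inverse u) (gen HF)"
  | "ev_gen u (LF N0) = smul u (gen HE)"
  | "ev_gen u (LK N0) = gen HKinv"
  | "ev_gen u (LKinv N0) = gen HK"
  | "ev_gen u (LE N1) = smul (inverse u) (gen HE)"
  | "ev_gen u (LF N1) = smul u (gen HF)"
  | "ev_gen u (LK N1) = gen HK"
  | "ev_gen u (LKinv N1) = gen HKinv"

text \<open>The evaluation map, from \<open>LUq q\<close> to \<open>Uq q\<close>.\<close>

definition ev :: "complex \<Rightarrow> complex \<Rightarrow> loop_gen free_alg set \<Rightarrow> sl2_gen free_alg set"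
  where "ev q u = induced (\<lambda>x. cls (Uq_rels q) (free_hom (ev_gen u) x))"


section \<open>Representations\<close>

text \<open>
  Throughout, \<open>s\<close> is the chosen square root of \<open>q\<close>. The power \<open>q\<^sup>x\<close> is only used for half-integers
  \<open>x\<close>, where it means \<open>s\<close> to the integer exponent \<open>2 * x\<close>. Spins and magnetic quantum numbers are
  real numbers, and the square roots in \<open>A\<close> and \<open>B\<close> are principal.
\<close>

definition qpow :: "complex \<Rightarrow> real \<Rightarrow> complex"
  where "qpow s x = s powi \<lfloor>2 * x\<rfloor>"

definition qnum :: "complex \<Rightarrow> real \<Rightarrow> complex"
  where "qnum s x = (qpow s x - qpow s (- x)) / (s\<^sup>2 - inverse (s\<^sup>2))"

definition A_coeff :: "complex \<Rightarrow> real \<Rightarrow> real \<Rightarrow> complex"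
  where "A_coeff s j m = csqrt (qnum s (j - m) * qnum s (j + m + 1))"

definition B_coeff :: "complex \<Rightarrow> real \<Rightarrow> real \<Rightarrow> complex"
  where "B_coeff s j m = csqrt (qnum s (j + m) * qnum s (j - m + 1))"

definition spin_dim :: "real \<Rightarrow> nat"
  where "spin_dim j = nat \<lfloor>2 * j + 1\<rfloor>"

text \<open>
  Rows and columns are numbered from 0, the number \<open>b\<close> belonging to the basis vector
  \<open>|j, m\<rangle>\<close> with \<open>m = j - b\<close>. So raising \<open>m\<close> by one lowers the number by one.
\<close>

fun spin_mat :: "complex \<Rightarrow> real \<Rightarrow> sl2_gen \<Rightarrow> complex mat"
  where
    "spin_mat s j HE = mat (spin_dim j) (spin_dim j)
       (\<lambda>(a, b). if a + 1 = b then A_coeff s j (j - real b) else 0)"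
  | "spin_mat s j HF = mat (spin_dim j) (spin_dim j)
       (\<lambda>(a, b). if a = b + 1 then B_coeff s j (j - real b) else 0)"
  | "spin_mat s j HK = mat (spin_dim j) (spin_dim j)
       (\<lambda>(a, b). if a = b then qpow s (j - real b) else 0)"
  | "spin_mat s j HKinv = mat (spin_dim j) (spin_dim j)
       (\<lambda>(a, b). if a = b then qpow s (- (j - real b)) else 0)"

definition spin_rep :: "complex \<Rightarrow> real \<Rightarrow> sl2_gen free_alg set \<Rightarrow> complex mat"
  where "spin_rep s j = induced (free_rep (spin_dim j) (spin_mat s j))"

definition eval_rep :: "complex \<Rightarrow> real \<Rightarrow> complex \<Rightarrow> loop_gen free_alg set \<Rightarrow> complex mat"
  where "eval_rep s j u X = spin_rep s j (ev (s\<^sup>2) u X)"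

text \<open>
  Kronecker product: the tensor basis is ordered lexicographically, i.e. the vector with number
  \<open>b\<close> in the first and \<open>c\<close> in the second factor has number \<open>b * n + c\<close>, where \<open>n\<close> is the dimension
  of the second factor.
\<close>

definition kron :: "complex mat \<Rightarrow> complex mat \<Rightarrow> complex mat"
  where "kron A B = mat (dim_row A * dim_row B) (dim_col A * dim_col B)
    (\<lambda>(a, b). A $$ (a div dim_row B, b div dim_col B) * B $$ (a mod dim_row B, b mod dim_col B))"

text \<open>
  The tensor product of two representations \<open>\<rho>\<close>, \<open>\<sigma>\<close> of \<open>LUq q\<close> of dimensions \<open>n\<close>, \<open>k\<close>, as a
  representation of \<open>LUq_tensor q\<close>.
\<close>

definition tensor_rep ::
  "complex \<Rightarrow> nat \<Rightarrow> nat \<Rightarrow> (loop_gen free_alg set \<Rightarrow> complex mat) \<Rightarrow>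
   (loop_gen free_alg set \<Rightarrow> complex mat) \<Rightarrow>
   (loop_gen free_monoid \<times> loop_gen free_monoid) monoid_alg set \<Rightarrow> complex mat"
  where "tensor_rep q n k \<rho> \<sigma> =
    induced (mat_lin_ext (n * k) (\<lambda>(v, w).
      kron (\<rho> (cls (LUq_rels q) (Poly_Mapping.single v 1)))
           (\<sigma> (cls (LUq_rels q) (Poly_Mapping.single w 1)))))"


section \<open>The intertwiners\<close>

definition is_LUq_intertwiner ::
  "complex \<Rightarrow> real \<Rightarrow> complex \<Rightarrow> complex \<Rightarrow> complex \<Rightarrow> complex mat \<Rightarrow> bool"
  where "is_LUq_intertwiner s j u u1 u2 M \<longleftrightarrow>
    (\<forall>X \<in> carrier (LUq (s\<^sup>2)).
       M * eval_rep s (j + 1/2) u X =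
       tensor_rep (s\<^sup>2) (spin_dim (1/2)) (spin_dim j) (eval_rep s (1/2) u1) (eval_rep s j u2)
         (coproduct (s\<^sup>2) X) * M)"

text \<open>Matrix entries numbered from 1.\<close>

definition entry :: "complex mat \<Rightarrow> nat \<Rightarrow> nat \<Rightarrow> complex"
  where "entry M a b = M $$ (a - 1, b - 1)"

definition fusion_entries :: "complex \<Rightarrow> real \<Rightarrow> complex mat \<Rightarrow> bool"
  where "fusion_entries s j M \<longleftrightarrow>
    (let N = nat \<lfloor>2 * j\<rfloor> in
     entry M 1 1 = 1 \<and>
     (\<forall>n\<in>{1..N}. entry M (1 + n) (1 + n) =
        (\<Prod>p<n. B_coeff s j (j - real p) / B_coeff s (j + 1/2) (j + 1/2 - real p))) \<and>
     (\<forall>m\<in>{1..N + 1}. entry M (N + 1 + m) (1 + m) =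
        qnum s (real m) * (entry M m m / B_coeff s (j + 1/2) (j + 3/2 - real m))) \<and>
     (\<forall>a\<in>{1..2 * N + 2}. \<forall>b\<in>{1..N + 2}.
        (a, b) \<notin> {(1, 1)} \<union> {(1 + n, 1 + n) | n. n \<in> {1..N}}
                \<union> {(N + 1 + m, 1 + m) | m. m \<in> {1..N + 1}} \<longrightarrow>
        entry M a b = 0))"

end

theory Submission
  imports Defs
begin

text \<open>
  It suffices to intertwine the generators, once the two sides are known to be representations
  of the quantum loop algebra, i.e. to vanish on its relators. In a basis the Cartan generators force
  \<open>\<E> |j+1/2, m\<rangle>\<close> to be a combination \<open>x\<^sub>b |\<up>\<rangle> \<otimes> |j, m-1/2\<rangle> + y\<^sub>b |\<down>\<rangle> \<otimes> |j, m+1/2\<rangle>\<close>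
  with \<open>b = j + 1/2 - m\<close>. Both \<open>E\<^sub>1\<close> and \<open>F\<^sub>0\<close> act as raising operators, and the equations that they
  impose differ only by \<open>q \<leftrightarrow> 1/q\<close>; together they determine \<open>y\<^sub>b\<close> and \<open>x\<^sub>b\<close> from
  \<open>x\<^bsub>b-1\<^esub>\<close>, so \<open>\<E>\<close> is determined by \<open>x\<^sub>0\<close>, and \<open>E\<^sub>0\<close>, \<open>F\<^sub>1\<close> impose nothing new.
\<close>

section \<open>An algebra of operators\<close>

text \<open>The evaluation parameters are chosen so that \<open>u\<close> drops out and raising
  equations come in mirror pairs. On a vector with second factor \<open>|j, j-c>\<close>, the first
  summands of Delta(E_1) and Delta(F_0) carry u1^-1 q^(j-c) and u1 q^-(j-c). With u1 = u q^-j and N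
  = 2j these are u^-1 q^(N-c) and u q^-(N-c); the value u2 = u q^(1/2) does the same for the second
  summands. Both equations have a common solution because [k+1] = q^k + q^-1 [k] = q^-k + q [k]. Two
  obstacles shape the proof. Maps on quotients act through an arbitrary representative of a coset,
  so independence of it must be shown; this is done after composing with operators. Principal square
  roots are not multiplicative, so equations are multiplied by nonzero coefficients until squares of
  roots can be evaluated. Intertwining is homogeneous while the normalisation of the top left entry
  is not. Hence the equivalence holds up to a nonzero scalar, and literally once that entry is
  1.\<close>

text \<open>
  All matrix algebras embed unitally into this one ring (see \<open>op_of_mat\<close> below). So noncommutative
  identities between square matrices of any size can be checked in the type class of rings.
\<close>

typedef linop =
  "{T :: (nat \<Rightarrow> complex) \<Rightarrow> nat \<Rightarrow> complex.
     (\<forall>f g. T (\<lambda>i. f i + g i) = (\<lambda>i. T f i + T g i)) \<and> (\<forall>c f. T (\<lambda>i. c * f i) = (\<lambda>i. c * T f i))}"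
  morphisms act Linop
  by (intro exI[of _ "\<lambda>f. f"]) auto

setup_lifting type_definition_linop

lemma act_scale: "act T (\<lambda>i. c * f i) i = c * act T f i"
  using act[of T] by auto

lemma act_zero: "act T (\<lambda>i. 0) i = 0"
  using act_scale[of T 0 "\<lambda>i. 0" i] by simp

lemma linop_eqI: "(\<And>f i. act S f i = act T f i) \<Longrightarrow> S = T"
  by (metis act_inject ext)

instantiation linop :: ring_1
begin

lift_definition zero_linop :: linop is "\<lambda>f i. 0" by simp
lift_definition one_linop :: linop is "\<lambda>f. f" by simp
lift_definition plus_linop :: "linop \<Rightarrow> linop \<Rightarrow> linop" is "\<lambda>S T f i. S f i + T f i"
  by (auto simp: algebra_simps)
lift_definition minus_linop :: "linop \<Rightarrow> linop \<Rightarrow> linop" is "\<lambda>S T f i. S f i - T f i"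
  by (auto simp: algebra_simps)
lift_definition uminus_linop :: "linop \<Rightarrow> linop" is "\<lambda>T f i. - T f i"
  by (auto simp: algebra_simps)
lift_definition times_linop :: "linop \<Rightarrow> linop \<Rightarrow> linop" is "\<lambda>S T f. S (T f)"
  by auto

instance
proof
  show "(0::linop) \<noteq> 1"
  proof
    assume "(0::linop) = 1"
    then have "act 0 (\<lambda>i. 1) 0 = act 1 (\<lambda>i. 1) 0" by simp
    then show False by (simp add: zero_linop.rep_eq one_linop.rep_eq)
  qed
qed (transfer; force simp: algebra_simps)+

end

lift_definition scl :: "complex \<Rightarrow> linop \<Rightarrow> linop" is "\<lambda>c T f i. c * T f i"
  by (auto simp: algebra_simps)

lemmas act_simps = zero_linop.rep_eq one_linop.rep_eq plus_linop.rep_eq minus_linop.rep_eq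
  uminus_linop.rep_eq times_linop.rep_eq scl.rep_eq

lemma scl_simps [simp]:
  "scl c S * T = scl c (S * T)" "S * scl c T = scl c (S * T)" "scl c (scl d T) = scl (c * d) T"
  "scl 1 T = T" "scl 0 T = 0" "scl c 0 = 0" 
  by (rule linop_eqI; simp add: act_simps act_scale act_zero)+

lemma scl_distrib:
  "scl c (S + T) = scl c S + scl c T" "scl c (S - T) = scl c S - scl c T"
  "scl c (- T) = - scl c T" "scl (c + d) T = scl c T + scl d T"
  by (rule linop_eqI; simp add: act_simps algebra_simps)+

lemma act_sum: "act (\<Sum>x\<in>X. T x) f i = (\<Sum>x\<in>X. act (T x) f i)"
  by (induction X rule: infinite_finite_induct) (auto simp: act_simps)

subsection \<open>Linear extension\<close>

definition op_ext :: "('m \<Rightarrow> linop) \<Rightarrow> 'm monoid_alg \<Rightarrow> linop"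
  where "op_ext r x = (\<Sum>w\<in>Poly_Mapping.keys x. scl (Poly_Mapping.lookup x w) (r w))"

lemma op_ext_superset:
  assumes "finite X" "Poly_Mapping.keys x \<subseteq> X"
  shows "op_ext r x = (\<Sum>w\<in>X. scl (Poly_Mapping.lookup x w) (r w))"
  unfolding op_ext_def using assms by (intro sum.mono_neutral_left) (auto simp: in_keys_iff)

lemma op_ext_add: "op_ext r (x + y) = op_ext r x + op_ext r y"
proof -
  let ?X = "Poly_Mapping.keys x \<union> Poly_Mapping.keys y"
  have "Poly_Mapping.keys (x + y) \<subseteq> ?X" by (rule keys_add)
  then show ?thesis
    by (simp add: op_ext_superset[of ?X] lookup_add scl_distrib sum.distrib)
qed

lemma op_ext_0 [simp]: "op_ext r 0 = 0"
  by (simp add: op_ext_def)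

lemma op_ext_minus: "op_ext r (x - y) = op_ext r x - op_ext r y"
  by (metis add_diff_cancel diff_add_cancel op_ext_add)

lemma op_ext_sum: "op_ext r (\<Sum>x\<in>X. f x) = (\<Sum>x\<in>X. op_ext r (f x))"
  by (induction X rule: infinite_finite_induct) (auto simp: op_ext_add)

lemma op_ext_single [simp]: "op_ext r (Poly_Mapping.single w c) = scl c (r w)"
  by (cases "c = 0") (auto simp: op_ext_def)

lemma monoid_alg_expand:
  "x = (\<Sum>w\<in>Poly_Mapping.keys x. Poly_Mapping.single w (Poly_Mapping.lookup x w))"
proof (rule poly_mapping_eqI)
  fix k
  show "Poly_Mapping.lookup x k = Poly_Mapping.lookup
     (\<Sum>w\<in>Poly_Mapping.keys x. Poly_Mapping.single w (Poly_Mapping.lookup x w)) k"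
    by (cases "k \<in> Poly_Mapping.keys x")
      (auto simp: lookup_sum lookup_single when_def in_keys_iff sum.delta)
qed

text \<open>Covers words and pairs of words alike, so that one treatment of linear extension and of
  quotients serves both the loop algebra and its tensor square.\<close>

definition monoid_rep :: "('m::monoid_add \<Rightarrow> linop) \<Rightarrow> bool"
  where "monoid_rep r \<longleftrightarrow> r 0 = 1 \<and> (\<forall>v w. r (v + w) = r v * r w)"

lemma op_ext_mult:
  assumes "monoid_rep r"
  shows "op_ext r (x * y) = op_ext r x * op_ext r y"
proof -
  let ?s = "\<lambda>z w. Poly_Mapping.single w (Poly_Mapping.lookup z w)"
  have "op_ext r (x * y) =
      op_ext r ((\<Sum>v\<in>Poly_Mapping.keys x. ?s x v) * (\<Sum>w\<in>Poly_Mapping.keys y. ?s y w))"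
    by (simp flip: monoid_alg_expand)
  also have "\<dots> = (\<Sum>v\<in>Poly_Mapping.keys x. \<Sum>w\<in>Poly_Mapping.keys y.
      scl (Poly_Mapping.lookup x v) (r v) * scl (Poly_Mapping.lookup y w) (r w))"
    using assms by (simp add: sum_product op_ext_sum mult_single monoid_rep_def mult.commute)
  also have "\<dots> = op_ext r x * op_ext r y"
    unfolding op_ext_def by (rule sum_product[symmetric])
  finally show ?thesis .
qed

lemma op_ext_one: "monoid_rep r \<Longrightarrow> op_ext r 1 = 1"
  by (simp add: monoid_rep_def flip: single_one)

lemma op_ext_smul: "monoid_rep r \<Longrightarrow> op_ext r (smul c x) = scl c (op_ext r x)"
  by (simp add: smul_def op_ext_mult) (simp add: monoid_rep_def)

lemma op_ext_prod_list:
  "monoid_rep r \<Longrightarrow> op_ext r (prod_list xs) = prod_list (map (op_ext r) xs)"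
  by (induction xs) (auto simp: op_ext_mult op_ext_one)

definition word_op :: "('g \<Rightarrow> linop) \<Rightarrow> 'g free_monoid \<Rightarrow> linop"
  where "word_op r w = prod_list (map r (letters w))"

lemma monoid_rep_word_op: "monoid_rep (word_op r)"
  by (auto simp: monoid_rep_def word_op_def zero_free_monoid_def plus_free_monoid_def)

lemma op_ext_gen [simp]: "op_ext (word_op r) (gen g) = r g"
  by (simp add: gen_def word_op_def)

text \<open>Through this, \<open>ev\<close> and \<open>coproduct\<close> are seen only by their
  effect on operators, where the images of the generators decide.\<close>

lemma op_ext_free_hom:
  assumes "monoid_rep r"
  shows "op_ext r (free_hom \<phi> x) = op_ext (word_op (\<lambda>g. op_ext r (\<phi> g))) x"
  using assms
  by (simp add: free_hom_def op_ext_sum op_ext_smul op_ext_prod_list op_ext_def[of "word_op _"]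
      word_op_def comp_def)

lemma op_ext_tens:
  assumes "\<And>v w. r (v, w) = r1 v * r2 w"
  shows "op_ext r (x \<otimes>\<^sub>a y) = op_ext r1 x * op_ext r2 y"
  by (simp add: tens_def op_ext_sum assms op_ext_def[of r1] op_ext_def[of r2] sum_product
      mult.commute)

subsection \<open>Presented algebras\<close>

lemma ring_monoid_alg_ring: "ring (monoid_alg_ring :: 'm::monoid_add monoid_alg ring)"
  by (rule ringI) (auto simp: monoid_alg_ring_def algebra_simps
      intro!: abelian_groupI monoidI exI[of _ "- _"] bexI[of _ "- _"])

text \<open>Being an ideal, the kernel contains the whole ideal generated by the relators as soon as
  it contains the relators.\<close>

lemma ideal_kernel:
  assumes "monoid_rep r"
  shows "ideal {x. op_ext r x = 0} (monoid_alg_ring :: 'm::monoid_add monoid_alg ring)"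
proof -
  interpret ring "monoid_alg_ring :: 'm monoid_alg ring" by (rule ring_monoid_alg_ring)
  have neg: "\<ominus>\<^bsub>monoid_alg_ring\<^esub> x = - x" for x :: "'m monoid_alg"
    by (rule minus_equality) (auto simp: monoid_alg_ring_def)
  show ?thesis
  proof (rule idealI[OF ring_monoid_alg_ring])
    show "subgroup {x. op_ext r x = 0} (add_monoid (monoid_alg_ring :: 'm monoid_alg ring))"
    proof (rule add.subgroupI)
      fix a :: "'m monoid_alg"
      assume "a \<in> {x. op_ext r x = 0}"
      then show "\<ominus>\<^bsub>monoid_alg_ring\<^esub> a \<in> {x. op_ext r x = 0}"
        unfolding neg using op_ext_minus[of r 0 a] by simp
    qed (auto simp: monoid_alg_ring_def op_ext_add intro: exI[of _ 0])
  qed (auto simp: monoid_alg_ring_def op_ext_mult[OF assms])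
qed

lemma ideal_Idl: "ideal (Idl\<^bsub>monoid_alg_ring\<^esub> R) (monoid_alg_ring :: 'm::monoid_add monoid_alg ring)"
  by (rule ring.genideal_ideal[OF ring_monoid_alg_ring]) (auto simp: monoid_alg_ring_def)

lemma mem_cls_self: "x \<in> cls R x"
proof -
  interpret ideal "Idl\<^bsub>monoid_alg_ring\<^esub> R" monoid_alg_ring by (rule ideal_Idl)
  have "0 \<in> Idl\<^bsub>monoid_alg_ring\<^esub> R"
    using additive_subgroup.zero_closed[OF is_additive_subgroup]
    by (simp add: monoid_alg_ring_def[THEN arg_cong[where f = ring.zero]])
  then show ?thesis
    by (auto simp: cls_def a_r_coset_def' monoid_alg_ring_def intro!: bexI[of _ 0])
qed

lemma op_ext_cls:
  assumes "monoid_rep r" "\<And>x. x \<in> R \<Longrightarrow> op_ext r x = 0" "y \<in> cls R x"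
  shows "op_ext r y = op_ext r x"
proof -
  have "Idl\<^bsub>monoid_alg_ring\<^esub> R \<subseteq> {x. op_ext r x = 0}"
    by (rule ring.genideal_minimal[OF ring_monoid_alg_ring ideal_kernel]) (use assms in auto)
  moreover obtain h where "h \<in> Idl\<^bsub>monoid_alg_ring\<^esub> R" "y = h + x"
    using assms(3) by (auto simp: cls_def a_r_coset_def' monoid_alg_ring_def)
  ultimately show ?thesis by (auto simp: op_ext_add)
qed

text \<open>The choice made by \<open>induced\<close> is sound because a coset is inhabited
  (\<open>mem_cls_self\<close>).\<close>

lemma induced_cls:
  assumes "\<And>y. y \<in> cls R x \<Longrightarrow> f y = f x"
  shows "induced f (cls R x) = f x"
  unfolding induced_def by (rule assms, rule someI[of "\<lambda>y. y \<in> cls R x"], rule mem_cls_self)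

lemma carrier_presented: "carrier (presented R) = range (cls R)"
  by (auto simp: presented_def cls_def FactRing_def A_RCOSETS_def' monoid_alg_ring_def)

section \<open>The relations for operators\<close>

text \<open>The expanded form of \<open>[X, [X, [X, Y]\<^sub>q]\<^bsub>1/q\<^esub>]\<close>.\<close>

definition serre :: "complex \<Rightarrow> linop \<Rightarrow> linop \<Rightarrow> linop"
  where "serre q X Y = X * X * X * Y - scl (q\<^sup>2 + 1 + (inverse q)\<^sup>2) (X * X * Y * X)
    + scl (q\<^sup>2 + 1 + (inverse q)\<^sup>2) (X * Y * X * X) - Y * X * X * X"

definition sl2_ops :: "complex \<Rightarrow> linop \<Rightarrow> linop \<Rightarrow> linop \<Rightarrow> linop \<Rightarrow> bool"
  where "sl2_ops q E F K K' \<longleftrightarrow> K * K' = 1 \<and> K' * K = 1 \<and> K * E = scl q (E * K) \<and>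
    K * F = scl (inverse q) (F * K) \<and>
    E * F - F * E = scl (1 / (q - inverse q)) (K * K - K' * K')"

definition loop_ops :: "complex \<Rightarrow> (loop_gen \<Rightarrow> linop) \<Rightarrow> bool"
  where "loop_ops q L \<longleftrightarrow>
    (\<forall>i. L (LK i) * L (LKinv i) = 1) \<and> (\<forall>i. L (LKinv i) * L (LK i) = 1) \<and>
    (\<forall>i k. L (LK i) * L (LE k) = scl (q powi (cartan i k div 2)) (L (LE k) * L (LK i))) \<and>
    (\<forall>i k. L (LK i) * L (LF k) = scl (q powi (- (cartan i k div 2))) (L (LF k) * L (LK i))) \<and>
    (\<forall>i k. L (LE i) * L (LF k) - L (LF k) * L (LE i) =
      (if i = k then scl (1 / (q - inverse q)) (L (LK i) * L (LK i) - L (LKinv i) * L (LKinv i)) else 0)) \<and>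
    L (LK N0) * L (LK N1) = 1 \<and> L (LK N1) * L (LK N0) = 1 \<and>
    (\<forall>i k. i \<noteq> k \<longrightarrow> serre q (L (LE i)) (L (LE k)) = 0 \<and> serre q (L (LF i)) (L (LF k)) = 0)"

text \<open>The two inner brackets give XXY - (q^2 + q^-2) XYX + YXX. The outer commutator adds 1 to
  the middle coefficient, whence [3]_q = q^2 + 1 + q^-2.\<close>

lemma qcomm_serre:
  assumes "q \<noteq> 0"
  shows "op_ext (word_op L) (comm x (qcomm (inverse q) x (qcomm q x y))) =
    serre q (op_ext (word_op L) x) (op_ext (word_op L) y)"
  using assms
  by (simp add: comm_def qcomm_def serre_def op_ext_minus op_ext_mult op_ext_smul monoid_rep_word_op,
      intro linop_eqI)
    (simp add: act_simps algebra_simps scl_distrib power2_eq_square)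

lemma op_ext_comm_gen:
  "op_ext (word_op L) (comm (gen g) (gen h)) = L g * L h - L h * L g"
  by (simp add: comm_def op_ext_minus op_ext_mult monoid_rep_word_op)

lemma op_ext_LUq_rels:
  assumes "loop_ops q L" "q \<noteq> 0" "x \<in> LUq_rels q"
  shows "op_ext (word_op L) x = 0"
  using assms(1,3) assms(2)
  unfolding LUq_rels_def Let_def loop_ops_def
  by (auto simp: op_ext_minus op_ext_mult op_ext_smul op_ext_one monoid_rep_word_op
      qcomm_serre op_ext_comm_gen)

lemma op_ext_Uq_rels:
  assumes "sl2_ops q (L HE) (L HF) (L HK) (L HKinv)" "x \<in> Uq_rels q"
  shows "op_ext (word_op L) x = 0"
  using assms unfolding Uq_rels_def Let_def sl2_ops_def
  by (auto simp: op_ext_minus op_ext_mult op_ext_smul op_ext_one monoid_rep_word_op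
      op_ext_comm_gen)

lemma inv_commute:
  assumes "K * K' = 1" "K' * K = 1" "K * X = scl c (X * K)" "c \<noteq> 0"
  shows "K' * X = scl (inverse c) (X * K')"
proof -
  have "scl c (K' * X) = K' * scl c (X * K) * K'"
    using assms(1) by (simp add: mult.assoc)
  also have "\<dots> = X * K'"
    using assms(2) by (simp flip: assms(3)) (simp flip: mult.assoc)
  finally show ?thesis
    using assms(4) by (metis left_inverse scl_simps(3,4))
qed

subsection \<open>The evaluation map\<close>

text \<open>The Chevalley involution. Evaluation sends node 0 to the swapped generators, so this
  carries facts about node 1 over to node 0.\<close>

lemma sl2_ops_swap:
  assumes "sl2_ops q E F K K'" "q \<noteq> 0"
  shows "sl2_ops q F E K' K"
proof -
  note * = assms[unfolded sl2_ops_def]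
  have "F * E - E * F = - (E * F - F * E)" by simp
  also have "\<dots> = scl (1 / (q - inverse q)) (K' * K' - K * K)"
    using * by (simp add: scl_distrib)
  finally show ?thesis
    using * inv_commute[of K K' E q] inv_commute[of K K' F "inverse q"] by (simp add: sl2_ops_def)
qed

text \<open>With H = [E,F] the expression is EEH - (q^2 + q^-2) EHE + HEE. Moving KK to the right in
  the three terms yields the factors 1, q^2, q^4, and 1 - (q^2 + q^-2) q^2 + q^4 = 0; for the
  inverse of K replace q by 1/q.\<close>

lemma sl2_serre:
  assumes "sl2_ops q E F K K'" "q \<noteq> 0"
  shows "serre q E F = 0"
proof -
  note * = assms[unfolded sl2_ops_def]
  define H where "H = E * F - F * E"
  have K: "K * E = scl q (E * K)" "K * (E * X) = scl q (E * (K * X))" for X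
    using * by (simp_all flip: mult.assoc)
  have K': "K' * E = scl (inverse q) (E * K')" "K' * (E * X) = scl (inverse q) (E * (K' * X))" for X
    using * inv_commute[of K K' E q] by (simp_all flip: mult.assoc)
  have "serre q E F = E * E * H - scl (q\<^sup>2 + (inverse q)\<^sup>2) (E * H * E) + H * E * E"
    unfolding serre_def H_def
    by (rule linop_eqI) (simp add: act_simps algebra_simps scl_distrib)
  also have "\<dots> = 0"
  proof -
    obtain c where c: "H = scl c (K * K - K' * K')"
      using * unfolding H_def by blast
    show ?thesis
      unfolding c using \<open>q \<noteq> 0\<close>
      by (intro linop_eqI, simp add: act_simps algebra_simps scl_distrib K K')
        (simp add: field_simps power2_eq_square)
  qed
  finally show ?thesis .
qed

fun eval_ops :: "(sl2_gen \<Rightarrow> linop) \<Rightarrow> complex \<Rightarrow> loop_gen \<Rightarrow> linop"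
  where
    "eval_ops S u (LE N0) = scl (inverse u) (S HF)"
  | "eval_ops S u (LF N0) = scl u (S HE)"
  | "eval_ops S u (LK N0) = S HKinv"
  | "eval_ops S u (LKinv N0) = S HK"
  | "eval_ops S u (LE N1) = scl (inverse u) (S HE)"
  | "eval_ops S u (LF N1) = scl u (S HF)"
  | "eval_ops S u (LK N1) = S HK"
  | "eval_ops S u (LKinv N1) = S HKinv"

lemma serre_scl: "serre q (scl c X) (scl d Y) = scl (c ^ 3 * d) (serre q X Y)"
  by (rule linop_eqI) (simp add: serre_def act_simps algebra_simps power3_eq_cube)

lemma node_all: "(\<forall>i. P i) \<longleftrightarrow> P N0 \<and> P N1"
  by (metis node.exhaust)

lemma loop_ops_eval:
  assumes "sl2_ops q (S HE) (S HF) (S HK) (S HKinv)" "q \<noteq> 0" "u \<noteq> 0"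
  shows "loop_ops q (eval_ops S u)"
  using assms(1) sl2_ops_swap[OF assms(1,2)] sl2_serre[OF assms(1,2)]
    sl2_serre[OF sl2_ops_swap[OF assms(1,2)] assms(2)] assms(2,3)
  by (auto simp: loop_ops_def sl2_ops_def node_all cartan_def serre_scl mult.commute)

subsection \<open>The coproduct\<close>

fun coproduct_ops :: "(loop_gen \<Rightarrow> linop) \<Rightarrow> (loop_gen \<Rightarrow> linop) \<Rightarrow> loop_gen \<Rightarrow> linop"
  where
    "coproduct_ops L L' (LE i) = L (LE i) * L' (LK i) + L (LKinv i) * L' (LE i)"
  | "coproduct_ops L L' (LF i) = L (LF i) * L' (LK i) + L (LKinv i) * L' (LF i)"
  | "coproduct_ops L L' (LK i) = L (LK i) * L' (LK i)"
  | "coproduct_ops L L' (LKinv i) = L (LKinv i) * L' (LKinv i)"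

lemma serre_inverse: "serre (inverse q) X Y = serre q X Y"
  by (simp add: serre_def add_ac)

text \<open>Each term of \<open>serre\<close> is linear in its last argument, so no word contains
  both \<open>c\<close> and \<open>d\<close>, and the exchange rules move all \<open>a\<close>,
  \<open>c\<close> to the left of all \<open>b\<close>, \<open>d\<close>. The mixed words then
  cancel: for instance aacb receives q^-2 + 1 + q^2 from the first term of \<open>serre\<close> and
  the opposite from the second.\<close>

lemma serre_add:
  assumes ac: "serre q a c = 0" and bd: "serre q b d = 0" and "q \<noteq> 0"
    and ba: "b * a = scl ((inverse q)\<^sup>2) (a * b)" and bc: "b * c = scl (q\<^sup>2) (c * b)"
    and da: "d * a = scl (q\<^sup>2) (a * d)"
  shows "serre q (a + b) (c + d) = 0"
proof -
  have r: "b * (a * X) = scl ((inverse q)\<^sup>2) (a * (b * X))" "b * (c * X) = scl (q\<^sup>2) (c * (b * X))"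
    "d * (a * X) = scl (q\<^sup>2) (a * (d * X))" for X
    using ba bc da by (simp_all flip: mult.assoc)
  have "serre q (a + b) (c + d) = serre q a c + serre q b d"
  proof -
    \<comment> \<open>\<open>p\<close> replaces 1/q and brings its cancellation rules along, so that
      the normal form stays polynomial.\<close>
    obtain p where p: "inverse q = p" "p * q = 1" "p * (q * x) = x" for x
      using \<open>q \<noteq> 0\<close> by simp
    show ?thesis
      unfolding serre_def
      by (rule linop_eqI)
        (simp add: act_simps algebra_simps scl_distrib r ba bc da p power2_eq_square)
  qed
  then show ?thesis using ac bd by simp
qed

text \<open>
  Below, the two summands of \<open>\<Delta>(E\<^sub>i)\<close> and of \<open>\<Delta>(E\<^sub>k)\<close> satisfy the hypotheses of \<open>serre_add\<close>;
  for \<open>F\<close> in place of \<open>E\<close> this holds with \<open>1/q\<close> in place of \<open>q\<close>, which does not change \<open>serre\<close>.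
\<close>

lemma serre_mult:
  assumes "serre q a c = 0" "k * k' = k' * k" "a * k = k * a" "c * k = k * c" 
    "a * k' = k' * a" "c * k' = k' * c"
  shows "serre q (a * k) (c * k') = 0" "serre q (k * a) (k' * c) = 0"
proof -
  have l: "k * (k' * X) = k' * (k * X)" "a * (k * X) = k * (a * X)" "c * (k * X) = k * (c * X)"
    "a * (k' * X) = k' * (a * X)" "c * (k' * X) = k' * (c * X)" for X
    using assms(2-) by (metis mult.assoc)+
  have "serre q (k * a) (k' * c) = k' * k * k * k * serre q a c"
    unfolding serre_def
    by (simp add: mult.assoc algebra_simps l assms(2-) scl_distrib)
  with assms show "serre q (k * a) (k' * c) = 0" by simp
  with assms show "serre q (a * k) (c * k') = 0" by simp
qed

text \<open>The commuting families \<open>L\<close> and \<open>L'\<close> stand for the two tensor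
  factors, so that compatibility of the coproduct with the relations becomes an identity in a single
  ring.\<close>

lemma loop_ops_coproduct:
  assumes L: "loop_ops q L" and L': "loop_ops q L'" and "q \<noteq> 0"
    and com: "\<And>g h. L' h * L g = L g * L' h"
  shows "loop_ops q (coproduct_ops L L')"
proof -
  note D = L[unfolded loop_ops_def] and D' = L'[unfolded loop_ops_def]
  let ?a = "\<lambda>i k. q powi (cartan i k div 2)"
  let ?b = "\<lambda>i k. q powi (- (cartan i k div 2))"
  have com': "L' h * (L g * X) = L g * (L' h * X)" for g h X
    using com by (simp flip: mult.assoc)
  have sym: "cartan k i = cartan i k" for i k
    by (auto simp: cartan_def)
  have ab: "?b i k = inverse (?a i k)" "?a i k \<noteq> 0" "?b i k \<noteq> 0" for i k
    using \<open>q \<noteq> 0\<close> by (simp_all add: power_int_minus)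
  have gen: "(M (LK i) * M (LE k) = scl (?a i k) (M (LE k) * M (LK i)) \<and>
      M (LKinv i) * M (LE k) = scl (?b i k) (M (LE k) * M (LKinv i)) \<and>
      M (LK i) * M (LF k) = scl (?b i k) (M (LF k) * M (LK i)) \<and>
      M (LKinv i) * M (LF k) = scl (?a i k) (M (LF k) * M (LKinv i))) \<and>
      (M (LK i) * M (LK k) = M (LK k) * M (LK i) \<and>
      M (LKinv i) * M (LKinv k) = M (LKinv k) * M (LKinv i) \<and>
      M (LKinv i) * M (LK k) = M (LK k) * M (LKinv i))"
    if M: "loop_ops q M" for M i k
  proof -
    note DM = M[unfolded loop_ops_def]
    have 1: "M (LKinv i) * M (LE k) = scl (?b i k) (M (LE k) * M (LKinv i))"
      using inv_commute[of "M (LK i)" "M (LKinv i)" "M (LE k)" "?a i k"] DM ab[of i k] by simp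
    have 2: "M (LKinv i) * M (LF k) = scl (?a i k) (M (LF k) * M (LKinv i))"
      using inv_commute[of "M (LK i)" "M (LKinv i)" "M (LF k)" "?b i k"] DM ab[of i k] by simp
    \<comment> \<open>As K_0 and K_1 are mutually inverse, only one Cartan element and its inverse
      remain, which settles all their commutations.\<close>
    have inv: "M (LKinv N1) = M (LK N0)" "M (LKinv N0) = M (LK N1)"
      using DM by (metis mult.assoc mult_1_left mult_1_right)+
    have "(M (LK i) * M (LK k) = M (LK k) * M (LK i) \<and>
      M (LKinv i) * M (LKinv k) = M (LKinv k) * M (LKinv i) \<and>
      M (LKinv i) * M (LK k) = M (LK k) * M (LKinv i))"
      using DM by (cases i; cases k) (simp_all add: inv)
    then show ?thesis using 1 2 DM by blast
  qed
  note E = gen[OF L, THEN conjunct1] gen[OF L', THEN conjunct1]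
  note K = gen[OF L, THEN conjunct2] gen[OF L', THEN conjunct2]
  have E_simps: "M (LK i) * (M (LE k) * X) = scl (?a i k) (M (LE k) * (M (LK i) * X))"
    "M (LKinv i) * (M (LE k) * X) = scl (?b i k) (M (LE k) * (M (LKinv i) * X))"
    "M (LK i) * (M (LF k) * X) = scl (?b i k) (M (LF k) * (M (LK i) * X))"
    "M (LKinv i) * (M (LF k) * X) = scl (?a i k) (M (LF k) * (M (LKinv i) * X))"
    if M: "loop_ops q M" for M i k X
    using gen[OF M, of i k] by (simp_all flip: mult.assoc)
  note ES = E_simps[OF L] E_simps[OF L']
  have inv_simps: "M (LK i) * (M (LKinv i) * X) = X" "M (LKinv i) * (M (LK i) * X) = X"
    if M: "loop_ops q M" for M i X
    using M[unfolded loop_ops_def] by (simp_all flip: mult.assoc)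
  note IS = inv_simps[OF L] inv_simps[OF L']
  have KS: "L (LKinv i) * (L (LK k) * X) = L (LK k) * (L (LKinv i) * X)"
    "L (LKinv i) * (L (LKinv k) * X) = L (LKinv k) * (L (LKinv i) * X)" for i k X
    using K(1)[of i k] by (metis mult.assoc)+
  let ?C = "coproduct_ops L L'"
  have "?C (LK i) * ?C (LKinv i) = 1" "?C (LKinv i) * ?C (LK i) = 1" for i
    using D D' by (simp_all add: mult.assoc com' IS)
  moreover have "?C (LK i) * ?C (LE k) = scl (?a i k) (?C (LE k) * ?C (LK i))"
    "?C (LK i) * ?C (LF k) = scl (?b i k) (?C (LF k) * ?C (LK i))" for i k
    using E[of i k] K[of k i]
    by (simp_all add: algebra_simps com com' ES KS scl_distrib mult.assoc)
  moreover have "?C (LK N0) * ?C (LK N1) = 1" "?C (LK N1) * ?C (LK N0) = 1"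
    using D D' by (simp_all add: mult.assoc com')
  moreover have "?C (LE i) * ?C (LF k) - ?C (LF k) * ?C (LE i) =
      (if i = k then scl (1 / (q - inverse q)) (?C (LK i) * ?C (LK i) - ?C (LKinv i) * ?C (LKinv i))
       else 0)" (is "?l = ?r") for i k
  proof -
    \<comment> \<open>The mixed terms cancel: the factor from moving K_k^-1 past E_i in one slot
      equals that from moving K_i past F_k in the other, because the Cartan matrix is
      symmetric.\<close>
    have "?l = (L (LE i) * L (LF k) - L (LF k) * L (LE i)) * (L' (LK i) * L' (LK k)) +
        L (LKinv i) * L (LKinv k) * (L' (LE i) * L' (LF k) - L' (LF k) * L' (LE i))"
      using E[of i k] E[of k i] K[of i k]
      by (simp add: algebra_simps com com' ES KS scl_distrib mult.assoc sym)
    also have "\<dots> = ?r"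
      using D D'
      by (auto simp: algebra_simps com com' scl_distrib mult.assoc)
    finally show ?thesis .
  qed
  moreover have "serre q (?C (LE i)) (?C (LE k)) = 0 \<and> serre q (?C (LF i)) (?C (LF k)) = 0"
    if "i \<noteq> k" for i k
  proof -
    have a: "?a i k = inverse q" "?a i i = q" "?b i k = q" "?b i i = inverse q"
      using that by (simp_all add: cartan_def power_int_minus)
    have "serre q (L (LE i) * L' (LK i)) (L (LE k) * L' (LK k)) = 0"
      "serre q (L (LKinv i) * L' (LE i)) (L (LKinv k) * L' (LE k)) = 0"
      "serre q (L (LF i) * L' (LK i)) (L (LF k) * L' (LK k)) = 0"
      "serre q (L (LKinv i) * L' (LF i)) (L (LKinv k) * L' (LF k)) = 0"
      using D D' K[of i k] that
        serre_mult(1)[of q "L (LE i)" "L (LE k)" "L' (LK i)" "L' (LK k)"]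
        serre_mult(2)[of q "L' (LE i)" "L' (LE k)" "L (LKinv i)" "L (LKinv k)"]
        serre_mult(1)[of q "L (LF i)" "L (LF k)" "L' (LK i)" "L' (LK k)"]
        serre_mult(2)[of q "L' (LF i)" "L' (LF k)" "L (LKinv i)" "L (LKinv k)"]
      by (simp_all add: com)
    moreover have "serre q (L (LE i) * L' (LK i) + L (LKinv i) * L' (LE i))
        (L (LE k) * L' (LK k) + L (LKinv k) * L' (LE k)) = 0"
      using E[of i k] E[of k i] E[of i i] K[of i k] \<open>q \<noteq> 0\<close>
      by (intro serre_add calculation)
        (simp_all add: mult.assoc com com' ES IS a sym power2_eq_square)
    moreover have "serre (inverse q) (L (LF i) * L' (LK i) + L (LKinv i) * L' (LF i))
        (L (LF k) * L' (LK k) + L (LKinv k) * L' (LF k)) = 0"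
      using E[of i k] E[of k i] E[of i i] K[of i k] \<open>q \<noteq> 0\<close>
      by (intro serre_add calculation[unfolded serre_inverse[of q, symmetric]])
        (simp_all add: mult.assoc com com' ES IS a sym power2_eq_square)
    ultimately show ?thesis by (simp add: serre_inverse)
  qed
  ultimately show ?thesis unfolding loop_ops_def by (intro conjI allI impI) blast+
qed

section \<open>Matrices as operators\<close>

text \<open>
  Splitting an index \<open>i\<close> into \<open>(i div n, i mod n)\<close>, this is the operator \<open>id \<otimes> A\<close> on
  \<open>\<complex>\<^sup>\<infinity> \<otimes> \<complex>\<^sup>n\<close>. Padding \<open>A\<close> with zeros instead would not preserve the unit.
\<close>

lift_definition op_of_mat :: "nat \<Rightarrow> complex mat \<Rightarrow> linop"
  is "\<lambda>n A f i. \<Sum>j<n. A $$ (i mod n, j) * f (n * (i div n) + j)"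
  by (auto simp: algebra_simps sum.distrib sum_distrib_left)

text \<open>Besides \<open>op_of_mat\<close> itself, the embeddings of either tensor factor are
  instances (\<open>mat_hom_kron\<close>). So the relations of a spin representation are verified
  once for all three.\<close>

definition mat_hom :: "nat \<Rightarrow> (complex mat \<Rightarrow> linop) \<Rightarrow> bool"
  where "mat_hom n \<psi> \<longleftrightarrow> \<psi> (1\<^sub>m n) = 1 \<and>
    (\<forall>A \<in> carrier_mat n n. \<forall>B \<in> carrier_mat n n. \<psi> (A * B) = \<psi> A * \<psi> B \<and> \<psi> (A + B) = \<psi> A + \<psi> B) \<and>
    (\<forall>A \<in> carrier_mat n n. \<forall>c. \<psi> (c \<cdot>\<^sub>m A) = scl c (\<psi> A))"

lemma mat_hom_op_of_mat:
  assumes "n > 0"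
  shows "mat_hom n (op_of_mat n)"
proof -
  have "op_of_mat n (1\<^sub>m n) = 1"
    by (rule linop_eqI)
      (use assms in \<open>simp add: op_of_mat.rep_eq act_simps if_distrib[of "\<lambda>x. x * _"] sum.delta cong: if_cong\<close>)
  moreover have "op_of_mat n (A * B) = op_of_mat n A * op_of_mat n B"
    if "A \<in> carrier_mat n n" "B \<in> carrier_mat n n" for A B
  proof (rule linop_eqI)
    fix f i
    have "act (op_of_mat n (A * B)) f i =
      (\<Sum>j<n. \<Sum>l<n. A $$ (i mod n, l) * B $$ (l, j) * f (n * (i div n) + j))"
      using that assms
      by (simp add: op_of_mat.rep_eq scalar_prod_def sum_distrib_right lessThan_atLeast0)
    also have "\<dots> = (\<Sum>l<n. \<Sum>j<n. A $$ (i mod n, l) * B $$ (l, j) * f (n * (i div n) + j))"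
      by (rule sum.swap)
    also have "\<dots> = act (op_of_mat n A * op_of_mat n B) f i"
      by (simp add: op_of_mat.rep_eq act_simps sum_distrib_left mult.assoc)
    finally show "act (op_of_mat n (A * B)) f i = act (op_of_mat n A * op_of_mat n B) f i" .
  qed
  moreover have "op_of_mat n (A + B) = op_of_mat n A + op_of_mat n B"
    if "A \<in> carrier_mat n n" "B \<in> carrier_mat n n" for A B
    by (rule linop_eqI)
      (use that assms in \<open>simp add: op_of_mat.rep_eq act_simps algebra_simps sum.distrib\<close>)
  moreover have "op_of_mat n (c \<cdot>\<^sub>m A) = scl c (op_of_mat n A)"
    if "A \<in> carrier_mat n n" for A c
    by (rule linop_eqI)
      (use that assms in \<open>simp add: op_of_mat.rep_eq act_simps algebra_simps sum_distrib_left\<close>)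
  ultimately show ?thesis by (simp add: mat_hom_def)
qed

text \<open>Indices below \<open>n\<close> form the block with \<open>i div n = 0\<close>; there,
  applying the operator to a delta function reads off a column.\<close>

lemma op_of_mat_inj:
  assumes "A \<in> carrier_mat n n" "B \<in> carrier_mat n n" "op_of_mat n A = op_of_mat n B"
  shows "A = B"
proof (rule eq_matI)
  fix i j assume ij: "i < dim_row B" "j < dim_col B"
  have *: "act (op_of_mat n C) (\<lambda>k. if k = j then 1 else 0) i = C $$ (i, j)" for C
    using ij assms
    by (simp add: op_of_mat.rep_eq if_distrib[of "\<lambda>x. _ * x"] sum.delta cong: if_cong)
  show "A $$ (i, j) = B $$ (i, j)"
    using *[of A] *[of B] assms(3) by simp
qed (use assms in auto)

definition word_mat :: "nat \<Rightarrow> ('g \<Rightarrow> complex mat) \<Rightarrow> 'g free_monoid \<Rightarrow> complex mat"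
  where "word_mat n \<rho> w = foldr (\<lambda>g M. \<rho> g * M) (letters w) (1\<^sub>m n)"

lemma word_mat_carrier:
  assumes "\<And>g. \<rho> g \<in> carrier_mat n n"
  shows "word_mat n \<rho> w \<in> carrier_mat n n"
proof -
  have "foldr (\<lambda>g M. \<rho> g * M) gs (1\<^sub>m n) \<in> carrier_mat n n" for gs
    by (induction gs) (use assms in \<open>auto intro: mult_carrier_mat\<close>)
  then show ?thesis by (simp add: word_mat_def)
qed

lemma word_op_mat:
  assumes "mat_hom n \<psi>" "\<And>g. \<rho> g \<in> carrier_mat n n"
  shows "\<psi> (word_mat n \<rho> w) = word_op (\<lambda>g. \<psi> (\<rho> g)) w"
proof -
  have "\<psi> (word_mat n \<rho> (Letters gs)) = word_op (\<lambda>g. \<psi> (\<rho> g)) (Letters gs)" for gs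
  proof (induction gs)
    case Nil
    show ?case using assms(1) by (simp add: word_mat_def word_op_def mat_hom_def)
  next
    case (Cons g gs)
    have "word_mat n \<rho> (Letters (g # gs)) = \<rho> g * word_mat n \<rho> (Letters gs)"
      by (simp add: word_mat_def)
    then show ?case
      using assms word_mat_carrier[of \<rho> n] Cons by (simp add: mat_hom_def word_op_def)
  qed
  then show ?thesis by (cases w) simp
qed

lemma op_of_mat_lin_ext:
  assumes "n > 0"
  shows "op_of_mat n (mat_lin_ext n \<rho> x) = op_ext (\<lambda>w. op_of_mat n (\<rho> w)) x"
  by (rule linop_eqI)
    (use assms in \<open>simp add: mat_lin_ext_def op_ext_def op_of_mat.rep_eq act_sum act_simps
      sum_distrib_left sum_distrib_right mult.assoc sum.swap[of _ _ "{..<n}"]\<close>)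

lemma mat_lin_ext_carrier [simp]: "mat_lin_ext n \<rho> x \<in> carrier_mat n n"
  by (simp add: mat_lin_ext_def)

lemma free_rep_eq: "free_rep n \<rho> = mat_lin_ext n (word_mat n \<rho>)"
  unfolding free_rep_def word_mat_def by simp

lemma op_ext_cong: "(\<And>w. r w = r' w) \<Longrightarrow> op_ext r x = op_ext r' x"
  by (simp add: op_ext_def)

lemma op_of_free_rep:
  assumes "n > 0" "\<And>g. \<rho> g \<in> carrier_mat n n"
  shows "op_of_mat n (free_rep n \<rho> x) = op_ext (word_op (\<lambda>g. op_of_mat n (\<rho> g))) x"
  using word_op_mat[where \<rho> = \<rho>, OF mat_hom_op_of_mat[OF assms(1)] assms(2)] assms(1)
  by (simp add: free_rep_eq op_of_mat_lin_ext cong: op_ext_cong)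

lemma free_rep_single:
  assumes "\<And>g. \<rho> g \<in> carrier_mat n n"
  shows "free_rep n \<rho> (Poly_Mapping.single w 1) = word_mat n \<rho> w"
  using word_mat_carrier[of \<rho> n w] assms
  by (intro eq_matI) (auto simp: free_rep_eq mat_lin_ext_def)

lemma free_rep_gen:
  assumes "\<And>g. \<rho> g \<in> carrier_mat n n"
  shows "free_rep n \<rho> (gen g) = \<rho> g"
  using free_rep_single[of \<rho> n "Letters [g]"] assms[of g] assms by (simp add: gen_def word_mat_def)

subsection \<open>Kronecker products\<close>

lemma kron_carrier [simp]:
  "A \<in> carrier_mat a b \<Longrightarrow> B \<in> carrier_mat c d \<Longrightarrow> kron A B \<in> carrier_mat (a * c) (b * d)"
  by (auto simp: kron_def)

lemma sum_div_mod:
  fixes g :: "nat \<Rightarrow> nat \<Rightarrow> 'a::comm_monoid_add"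
  shows "(\<Sum>l<n * k. g (l div k) (l mod k)) = (\<Sum>a<n. \<Sum>c<k. g a c)"
proof (cases "k = 0")
  case False
  have "(\<Sum>l<n * k. g (l div k) (l mod k)) = (\<Sum>(a, c)\<in>{..<n} \<times> {..<k}. g a c)"
  proof (rule sum.reindex_bij_witness[where i = "\<lambda>(a, c). a * k + c" and j = "\<lambda>l. (l div k, l mod k)"])
    fix b assume "b \<in> {..<n} \<times> {..<k}"
    then obtain a c where "b = (a, c)" "a < n" "c < k" by auto
    moreover have "a * k + c < n * k"
      using \<open>a < n\<close> \<open>c < k\<close> by (metis add_less_cancel_left less_le_trans mult_Suc mult_le_mono1 Suc_leI add.commute)
    ultimately show "(case b of (a, c) \<Rightarrow> a * k + c) \<in> {..<n * k}" by simp
  qed (use False in \<open>auto simp: less_mult_imp_div_less\<close>)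
  then show ?thesis by (simp add: sum.cartesian_product)
qed simp

lemma kron_mult:
  assumes "A \<in> carrier_mat n n" "C \<in> carrier_mat n n" "B \<in> carrier_mat k k" "D \<in> carrier_mat k k"
  shows "kron A B * kron C D = kron (A * C) (B * D)"
proof (rule eq_matI)
  fix i j assume "i < dim_row (kron (A * C) (B * D))" "j < dim_col (kron (A * C) (B * D))"
  then have ij: "i < n * k" "j < n * k" using assms by (auto simp: kron_def)
  then have k: "k > 0" by (cases k) auto
  have d: "i div k < n" "j div k < n" "i mod k < k" "j mod k < k"
    using ij k by (auto simp: less_mult_imp_div_less)
  have "(kron A B * kron C D) $$ (i, j) =
     (\<Sum>l<n * k. A $$ (i div k, l div k) * B $$ (i mod k, l mod k) * (C $$ (l div k, j div k) * D $$ (l mod k, j mod k)))"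
    using ij assms by (simp add: kron_def scalar_prod_def lessThan_atLeast0)
  also have "\<dots> = (\<Sum>a<n. \<Sum>c<k. A $$ (i div k, a) * B $$ (i mod k, c) * (C $$ (a, j div k) * D $$ (c, j mod k)))"
    by (rule sum_div_mod)
  also have "\<dots> = (\<Sum>a<n. A $$ (i div k, a) * C $$ (a, j div k)) * (\<Sum>c<k. B $$ (i mod k, c) * D $$ (c, j mod k))"
    by (simp add: sum_product mult_ac)
  also have "\<dots> = kron (A * C) (B * D) $$ (i, j)"
    using ij d assms by (simp add: kron_def scalar_prod_def lessThan_atLeast0)
  finally show "(kron A B * kron C D) $$ (i, j) = kron (A * C) (B * D) $$ (i, j)" .
qed (use assms in \<open>auto simp: kron_def\<close>)

lemma kron_one: "kron (1\<^sub>m n) (1\<^sub>m k) = 1\<^sub>m (n * k)"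
proof (rule eq_matI)
  fix i j assume "i < dim_row (1\<^sub>m (n * k) :: complex mat)" "j < dim_col (1\<^sub>m (n * k) :: complex mat)"
  then have ij: "i < n * k" "j < n * k" by auto
  then have k: "k > 0" by (cases k) auto
  have "i div k < n" "j div k < n" "i mod k < k" "j mod k < k"
    using ij k by (auto simp: less_mult_imp_div_less)
  moreover have "i = j" if "i div k = j div k" "i mod k = j mod k"
    using that by (metis div_mult_mod_eq)
  ultimately show "kron (1\<^sub>m n) (1\<^sub>m k) $$ (i, j) = (1\<^sub>m (n * k) :: complex mat) $$ (i, j)"
    using ij by (auto simp: kron_def)
qed (auto simp: kron_def)

lemma mat_hom_kron:
  assumes "n > 0" "k > 0"
  shows "mat_hom n (\<lambda>A. op_of_mat (n * k) (kron A (1\<^sub>m k)))" (is ?A)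
    and "mat_hom k (\<lambda>B. op_of_mat (n * k) (kron (1\<^sub>m n) B))" (is ?B)
proof -
  have h: "mat_hom (n * k) (op_of_mat (n * k))"
    using assms by (intro mat_hom_op_of_mat) simp
  have m: "kron (A * B) (1\<^sub>m k) = kron A (1\<^sub>m k) * kron B (1\<^sub>m k)"
    "kron (A + B) (1\<^sub>m k) = kron A (1\<^sub>m k) + kron B (1\<^sub>m k)"
    "kron (c \<cdot>\<^sub>m A) (1\<^sub>m k) = c \<cdot>\<^sub>m kron A (1\<^sub>m k)"
    if "A \<in> carrier_mat n n" "B \<in> carrier_mat n n" for A B c
    using that kron_mult[of A n B "1\<^sub>m k" k "1\<^sub>m k"]
    by (auto intro!: eq_matI simp: kron_def less_mult_imp_div_less algebra_simps)
  have m': "kron (1\<^sub>m n) (A * B) = kron (1\<^sub>m n) A * kron (1\<^sub>m n) B"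
    "kron (1\<^sub>m n) (A + B) = kron (1\<^sub>m n) A + kron (1\<^sub>m n) B"
    "kron (1\<^sub>m n) (c \<cdot>\<^sub>m A) = c \<cdot>\<^sub>m kron (1\<^sub>m n) A"
    if "A \<in> carrier_mat k k" "B \<in> carrier_mat k k" for A B c
    using that assms kron_mult[of "1\<^sub>m n" n "1\<^sub>m n" A k B]
    by (auto intro!: eq_matI simp: kron_def less_mult_imp_div_less algebra_simps)
  show ?A
    using h m by (auto simp: mat_hom_def kron_one)
  show ?B
    using h m' by (auto simp: mat_hom_def kron_one)
qed

text \<open>The two orders together say that the tensor factors commute, as
  \<open>loop_ops_coproduct\<close> demands.\<close>

lemma op_of_kron:
  assumes "A \<in> carrier_mat n n" "B \<in> carrier_mat k k" "n > 0" "k > 0"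
  shows "op_of_mat (n * k) (kron A B) =
      op_of_mat (n * k) (kron A (1\<^sub>m k)) * op_of_mat (n * k) (kron (1\<^sub>m n) B)"
    and "op_of_mat (n * k) (kron A B) =
      op_of_mat (n * k) (kron (1\<^sub>m n) B) * op_of_mat (n * k) (kron A (1\<^sub>m k))"
proof -
  have h: "mat_hom (n * k) (op_of_mat (n * k))"
    using assms by (intro mat_hom_op_of_mat) simp
  have "kron A B = kron A (1\<^sub>m k) * kron (1\<^sub>m n) B" "kron A B = kron (1\<^sub>m n) B * kron A (1\<^sub>m k)"
    using assms by (subst kron_mult[of _ n _ _ k]; simp)+
  then show "op_of_mat (n * k) (kron A B) =
      op_of_mat (n * k) (kron A (1\<^sub>m k)) * op_of_mat (n * k) (kron (1\<^sub>m n) B)"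
    "op_of_mat (n * k) (kron A B) =
      op_of_mat (n * k) (kron (1\<^sub>m n) B) * op_of_mat (n * k) (kron A (1\<^sub>m k))"
    using h assms unfolding mat_hom_def by (metis kron_carrier one_carrier_mat)+
qed

section \<open>The spin representations\<close>

text \<open>Quantum integers at integer arguments contain no half power of q, so they depend on
  \<open>s\<close> only through \<open>s\<^sup>2\<close>.\<close>

definition qn :: "complex \<Rightarrow> int \<Rightarrow> complex"
  where "qn q k = (q powi k - q powi (- k)) / (q - inverse q)"

text \<open>With \<open>j = N/2\<close>, this is \<open>A\<^bsub>j,j-b\<^esub> = B\<^bsub>j,j-b+1\<^esub>\<close>; see \<open>A_coeff_ladder\<close> and \<open>B_coeff_ladder\<close>.\<close>

definition ladder :: "complex \<Rightarrow> nat \<Rightarrow> nat \<Rightarrow> complex"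
  where "ladder q N b = csqrt (qn q (int b) * qn q (int N + 1 - int b))"

lemma qn_0 [simp]: "qn q 0 = 0"
  by (simp add: qn_def)

text \<open>The ladder breaks off at both ends, which closes the boundary cases of [E,F] and of the
  recurrences.\<close>

lemma ladder_0 [simp]: "ladder q N 0 = 0" "ladder q N (Suc N) = 0"
  by (simp_all add: ladder_def)

text \<open>Roots of products are never merged or split. Apart from the special values
  \<open>csqrt 0\<close> and \<open>csqrt 1\<close>, the root is evaluated only through its
  square.\<close>

lemma ladder_square: "ladder q N b * ladder q N b = qn q (int b) * qn q (int N + 1 - int b)"
  by (metis ladder_def power2_csqrt power2_eq_square)

lemma qpow_of_int: "2 * x = of_int k \<Longrightarrow> qpow s x = s powi k"
  by (simp add: qpow_def)

lemma qnum_of_int: "qnum s (of_int k) = qn (s\<^sup>2) k"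
proof -
  have "s powi (2 * k) = s\<^sup>2 powi k" for k
    by (simp add: power_int_mult)
  from this[of k] this[of "- k"] show ?thesis
    by (simp add: qnum_def qn_def qpow_of_int[of _ "2 * k"] qpow_of_int[of _ "- 2 * k"])
qed

lemma A_coeff_ladder:
  assumes "2 * j = real N"
  shows "A_coeff s j (j - real b) = ladder (s\<^sup>2) N b"
proof -
  have "j + (j - real b) + 1 = of_int (int N + 1 - int b)" "j - (j - real b) = of_int (int b)"
    using assms by simp_all
  then show ?thesis by (simp only: A_coeff_def ladder_def qnum_of_int)
qed

lemma B_coeff_ladder:
  assumes "2 * j = real N"
  shows "B_coeff s j (j - real b) = ladder (s\<^sup>2) N (Suc b)"
proof -
  have "j + (j - real b) = of_int (int N + 1 - int (Suc b))"
    "j - (j - real b) + 1 = of_int (int (Suc b))"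
    using assms by simp_all
  then show ?thesis by (simp only: B_coeff_def ladder_def qnum_of_int mult.commute)
qed

lemma qpow_weight:
  assumes "2 * j = real N"
  shows "qpow s (j - real b) = s powi (int N - 2 * int b)"
    "qpow s (real b - j) = s powi (2 * int b - int N)"
  using assms by (auto intro!: qpow_of_int)

lemma spin_dim_eq: "2 * j = real N \<Longrightarrow> spin_dim j = Suc N"
  by (simp add: spin_dim_def nat_add_distrib)

lemma spin_mat_eq:
  assumes "2 * j = real N"
  shows "spin_mat s j HE = mat (Suc N) (Suc N) (\<lambda>(a, b). if b = Suc a then ladder (s\<^sup>2) N b else 0)"
    and "spin_mat s j HF = mat (Suc N) (Suc N) (\<lambda>(a, b). if a = Suc b then ladder (s\<^sup>2) N a else 0)"
    and "spin_mat s j HK = mat (Suc N) (Suc N) (\<lambda>(a, b). if a = b then s powi (int N - 2 * int b) else 0)"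
    and "spin_mat s j HKinv = mat (Suc N) (Suc N) (\<lambda>(a, b). if a = b then s powi (2 * int b - int N) else 0)"
  by (intro eq_matI; auto simp: spin_dim_eq[OF assms] A_coeff_ladder[OF assms] B_coeff_ladder[OF assms]
      qpow_weight[OF assms] simp del: of_nat_Suc)+

lemma spin_mat_carrier:
  assumes "2 * j = real N"
  shows "spin_mat s j g \<in> carrier_mat (Suc N) (Suc N)"
  by (cases g) (simp_all add: spin_dim_eq[OF assms])

text \<open>This is the relation for [E,F] on the vector number \<open>a\<close> of spin N/2, where
  K acts by q^(N-2a). In terms of X = q^N and Y = q^a it is an identity of rational
  functions.\<close>

lemma qn_ladder_identity:
  assumes "q \<noteq> 0" "q \<noteq> inverse q"
  shows "qn q (a + 1) * qn q (N - a) - qn q a * qn q (N + 1 - a) =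
    (q powi (N - 2 * a) - q powi (2 * a - N)) / (q - inverse q)"
proof -
  define X Y where "X = q powi N" and "Y = q powi a"
  have nz: "X \<noteq> 0" "Y \<noteq> 0" using assms by (simp_all add: X_def Y_def)
  have e: "q powi (a + 1) = q * Y" "q powi (- (a + 1)) = inverse (q * Y)"
    "q powi (N - a) = X / Y" "q powi (- (N - a)) = Y / X"
    "q powi a = Y" "q powi (- a) = inverse Y"
    "q powi (N + 1 - a) = q * X / Y" "q powi (- (N + 1 - a)) = Y / (q * X)"
    "q powi (N - 2 * a) = X / Y\<^sup>2" "q powi (2 * a - N) = Y\<^sup>2 / X"
    using assms
    by (simp_all add: X_def Y_def power_int_add power_int_diff power_int_minus power_int_mult
        power2_eq_square field_simps)
  define d where "d = q - inverse q"
  have d: "d \<noteq> 0" using assms by (simp add: d_def)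
  have "(q * Y - inverse (q * Y)) * (X / Y - Y / X) - (Y - inverse Y) * (q * X / Y - Y / (q * X)) =
    (X / Y\<^sup>2 - Y\<^sup>2 / X) * d"
    using nz assms(1) unfolding d_def by (simp add: field_simps power2_eq_square)
  then have "(q * Y - inverse (q * Y)) / d * ((X / Y - Y / X) / d)
      - (Y - inverse Y) / d * ((q * X / Y - Y / (q * X)) / d) = (X / Y\<^sup>2 - Y\<^sup>2 / X) / d"
    using d by (simp add: times_divide_times_eq flip: diff_divide_distrib)
  then show ?thesis
    unfolding qn_def e d_def[symmetric] .
qed

lemma sl2_ops_spin:
  assumes j: "2 * j = real N" and s: "s \<noteq> 0" "s\<^sup>2 \<noteq> inverse (s\<^sup>2)" and \<psi>: "mat_hom (Suc N) \<psi>"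
  defines "S \<equiv> \<lambda>g. \<psi> (spin_mat s j g)"
  shows "sl2_ops (s\<^sup>2) (S HE) (S HF) (S HK) (S HKinv)"
proof -
  let ?M = "spin_mat s j"
  note eq = spin_mat_eq[OF j, of s] and carr = spin_mat_carrier[OF j, of s]
  note entry = times_mat_def scalar_prod_def sum.delta if_distrib[of "\<lambda>x. x * _"] if_distrib[of "\<lambda>x. _ * x"]
  have "?M HK * ?M HKinv = 1\<^sub>m (Suc N)" "?M HKinv * ?M HK = 1\<^sub>m (Suc N)"
  proof -
    have "s powi (int N - 2 * int b) * s powi (2 * int b - int N) = 1"
      "s powi (2 * int b - int N) * s powi (int N - 2 * int b) = 1" for b
      using s by (simp_all flip: power_int_add)
    then show "?M HK * ?M HKinv = 1\<^sub>m (Suc N)" "?M HKinv * ?M HK = 1\<^sub>m (Suc N)"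
      unfolding eq by (intro eq_matI; auto simp: entry simp del: sum.op_ivl_Suc cong: if_cong)+
  qed
  moreover have "?M HK * ?M HE = s\<^sup>2 \<cdot>\<^sub>m (?M HE * ?M HK)"
  proof -
    have w: "s powi (int N - 2 * int a) = s\<^sup>2 * s powi (int N - 2 * int (Suc a))" for a
      using s by (simp add: power_int_diff power_int_add power2_eq_square field_simps)
    show ?thesis
    proof (rule eq_matI)
      fix a b assume "a < dim_row (s\<^sup>2 \<cdot>\<^sub>m (?M HE * ?M HK))" "b < dim_col (s\<^sup>2 \<cdot>\<^sub>m (?M HE * ?M HK))"
      then show "(?M HK * ?M HE) $$ (a, b) = (s\<^sup>2 \<cdot>\<^sub>m (?M HE * ?M HK)) $$ (a, b)"
        using w[of a] unfolding eq
        by (cases "b = Suc a")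
          (auto simp: entry simp del: sum.op_ivl_Suc of_nat_Suc cong: if_cong)
    qed (simp_all add: spin_dim_eq[OF j])
  qed
  moreover have "?M HK * ?M HF = inverse (s\<^sup>2) \<cdot>\<^sub>m (?M HF * ?M HK)"
  proof -
    have w: "s powi (int N - 2 * int (Suc a)) = inverse (s\<^sup>2) * s powi (int N - 2 * int a)" for a
      using s by (simp add: power_int_diff power_int_add power2_eq_square field_simps)
    show ?thesis
    proof (rule eq_matI)
      fix a b assume "a < dim_row (inverse (s\<^sup>2) \<cdot>\<^sub>m (?M HF * ?M HK))"
        "b < dim_col (inverse (s\<^sup>2) \<cdot>\<^sub>m (?M HF * ?M HK))"
      then show "(?M HK * ?M HF) $$ (a, b) = (inverse (s\<^sup>2) \<cdot>\<^sub>m (?M HF * ?M HK)) $$ (a, b)"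
        using w[of b] unfolding eq
        by (cases "a = Suc b")
          (auto simp: entry simp del: sum.op_ivl_Suc of_nat_Suc cong: if_cong)
    qed (simp_all add: spin_dim_eq[OF j])
  qed
  \<comment> \<open>Differences are written as sums with a multiple by -1, since
    \<open>mat_hom\<close> speaks of sums and scalar multiples.\<close>
  moreover have "?M HE * ?M HF + (-1) \<cdot>\<^sub>m (?M HF * ?M HE) =
      (1 / (s\<^sup>2 - inverse (s\<^sup>2))) \<cdot>\<^sub>m (?M HK * ?M HK + (-1) \<cdot>\<^sub>m (?M HKinv * ?M HKinv))"
  proof (rule eq_matI)
    fix a b
    assume "a < dim_row ((1 / (s\<^sup>2 - inverse (s\<^sup>2))) \<cdot>\<^sub>m (?M HK * ?M HK + (-1) \<cdot>\<^sub>m (?M HKinv * ?M HKinv)))"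
      "b < dim_col ((1 / (s\<^sup>2 - inverse (s\<^sup>2))) \<cdot>\<^sub>m (?M HK * ?M HK + (-1) \<cdot>\<^sub>m (?M HKinv * ?M HKinv)))"
    then have ab: "a < Suc N" "b < Suc N" by (simp_all add: spin_dim_eq[OF j])
    \<comment> \<open>For \<open>a = N\<close> there is no intermediate vector, and
      \<open>ladder_0\<close> makes the right-hand side vanish too; likewise for
      \<open>a = 0\<close> in 2.\<close>
    have 1: "(?M HE * ?M HF) $$ (a, b) =
        (if a = b then ladder (s\<^sup>2) N (Suc a) * ladder (s\<^sup>2) N (Suc a) else 0)"
      using ab unfolding eq by (cases "a = N") (auto simp: entry cong: if_cong)
    have 2: "(?M HF * ?M HE) $$ (a, b) = (if a = b then ladder (s\<^sup>2) N a * ladder (s\<^sup>2) N a else 0)"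
      using ab unfolding eq by (cases a) (auto simp: entry cong: if_cong)
    have 3: "(?M HK * ?M HK) $$ (a, b) = (if a = b then s\<^sup>2 powi (int N - 2 * int a) else 0)"
      "(?M HKinv * ?M HKinv) $$ (a, b) = (if a = b then s\<^sup>2 powi (2 * int a - int N) else 0)"
      using ab unfolding eq
      by (auto simp: entry power2_eq_square power_int_mult_distrib cong: if_cong)
    show "(?M HE * ?M HF + (-1) \<cdot>\<^sub>m (?M HF * ?M HE)) $$ (a, b) =
      ((1 / (s\<^sup>2 - inverse (s\<^sup>2))) \<cdot>\<^sub>m (?M HK * ?M HK + (-1) \<cdot>\<^sub>m (?M HKinv * ?M HKinv))) $$ (a, b)"
    proof -
      have e: "(P + (-1) \<cdot>\<^sub>m Q) $$ (a, b) = P $$ (a, b) - Q $$ (a, b)"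
        "(c \<cdot>\<^sub>m (P + (-1) \<cdot>\<^sub>m Q)) $$ (a, b) = c * (P $$ (a, b) - Q $$ (a, b))"
        if "P \<in> carrier_mat (Suc N) (Suc N)" "Q \<in> carrier_mat (Suc N) (Suc N)" for P Q :: "complex mat" and c
        using ab that by auto
      note c = mult_carrier_mat[OF carr carr]
      show ?thesis
        unfolding e(1)[OF c c] e(2)[OF c c] 1 2 3
        using qn_ladder_identity[of "s\<^sup>2" "int a" "int N"] s
        by (cases "a = b") (simp_all add: ladder_square add.commute)
    qed
  qed (simp_all add: spin_dim_eq[OF j])
  ultimately have R: "\<psi> (?M HK * ?M HKinv) = 1" "\<psi> (?M HKinv * ?M HK) = 1"
    "\<psi> (?M HK * ?M HE) = \<psi> (s\<^sup>2 \<cdot>\<^sub>m (?M HE * ?M HK))"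
    "\<psi> (?M HK * ?M HF) = \<psi> (inverse (s\<^sup>2) \<cdot>\<^sub>m (?M HF * ?M HK))"
    "\<psi> (?M HE * ?M HF + (-1) \<cdot>\<^sub>m (?M HF * ?M HE)) =
      \<psi> ((1 / (s\<^sup>2 - inverse (s\<^sup>2))) \<cdot>\<^sub>m (?M HK * ?M HK + (-1) \<cdot>\<^sub>m (?M HKinv * ?M HKinv)))"
    using \<psi> by (simp_all add: mat_hom_def)
  have hom: "\<psi> (A * B) = \<psi> A * \<psi> B" "\<psi> (A + B) = \<psi> A + \<psi> B" "\<psi> (c \<cdot>\<^sub>m A) = scl c (\<psi> A)"
    if "A \<in> carrier_mat (Suc N) (Suc N)" "B \<in> carrier_mat (Suc N) (Suc N)" for A B c
    using \<psi> that by (simp_all add: mat_hom_def)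
  have m: "scl (- 1) T = - T" for T
    by (rule linop_eqI) (simp add: act_simps)
  note c = carr mult_carrier_mat[OF carr carr] smult_carrier_mat[OF mult_carrier_mat[OF carr carr]]
    add_carrier_mat[OF smult_carrier_mat[OF mult_carrier_mat[OF carr carr]]]
  show ?thesis
    using R unfolding sl2_ops_def S_def
    by (simp add: hom[OF c(1) c(1)] hom(2)[OF c(2) c(3)] hom(3)[OF c(2) c(2)] hom(3)[OF c(4) c(4)] m
        del: spin_mat.simps)
qed

section \<open>Evaluation and tensor product representations\<close>

fun loop_mat :: "complex \<Rightarrow> real \<Rightarrow> complex \<Rightarrow> loop_gen \<Rightarrow> complex mat"
  where
    "loop_mat s j u (LE N0) = inverse u \<cdot>\<^sub>m spin_mat s j HF"
  | "loop_mat s j u (LF N0) = u \<cdot>\<^sub>m spin_mat s j HE"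
  | "loop_mat s j u (LK N0) = spin_mat s j HKinv"
  | "loop_mat s j u (LKinv N0) = spin_mat s j HK"
  | "loop_mat s j u (LE N1) = inverse u \<cdot>\<^sub>m spin_mat s j HE"
  | "loop_mat s j u (LF N1) = u \<cdot>\<^sub>m spin_mat s j HF"
  | "loop_mat s j u (LK N1) = spin_mat s j HK"
  | "loop_mat s j u (LKinv N1) = spin_mat s j HKinv"

lemma loop_gen_cases:
  obtains "g = LE N0" | "g = LF N0" | "g = LK N0" | "g = LKinv N0"
    | "g = LE N1" | "g = LF N1" | "g = LK N1" | "g = LKinv N1"
proof (cases g)
  case (LE i) with that show ?thesis by (cases i) auto
next
  case (LF i) with that show ?thesis by (cases i) auto
next
  case (LK i) with that show ?thesis by (cases i) auto
next
  case (LKinv i) with that show ?thesis by (cases i) auto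
qed

lemma loop_mat_carrier:
  assumes "2 * j = real N"
  shows "loop_mat s j u g \<in> carrier_mat (Suc N) (Suc N)"
  using spin_mat_carrier[OF assms, of s]
  by (cases g rule: loop_gen_cases) (simp_all del: spin_mat.simps)

lemma loop_mat_hom:
  assumes "2 * j = real N" "mat_hom (Suc N) \<psi>"
  shows "\<psi> (loop_mat s j u g) = eval_ops (\<lambda>g. \<psi> (spin_mat s j g)) u g"
  using assms(2) spin_mat_carrier[OF assms(1), of s]
  by (cases g rule: loop_gen_cases) (simp_all add: mat_hom_def del: spin_mat.simps)

lemma loop_ops_loop_mat:
  assumes "2 * j = real N" "mat_hom (Suc N) \<psi>" "s \<noteq> 0" "s\<^sup>2 \<noteq> inverse (s\<^sup>2)" "u \<noteq> 0"
  shows "loop_ops (s\<^sup>2) (\<lambda>g. \<psi> (loop_mat s j u g))"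
  using loop_ops_eval[of "s\<^sup>2" "\<lambda>g. \<psi> (spin_mat s j g)" u] sl2_ops_spin[OF assms(1,3,4,2)] assms
  by (simp add: loop_mat_hom del: spin_mat.simps)

lemma op_ext_ev_gen: "op_ext (word_op S) (ev_gen u g) = eval_ops S u g"
  by (cases g rule: loop_gen_cases) (simp_all add: op_ext_smul monoid_rep_word_op)

lemma free_rep_carrier [simp]: "free_rep n \<rho> x \<in> carrier_mat n n"
  by (simp add: free_rep_def)

lemma spin_rep_cls:
  assumes "2 * j = real N" "s \<noteq> 0" "s\<^sup>2 \<noteq> inverse (s\<^sup>2)"
  shows "spin_rep s j (cls (Uq_rels (s\<^sup>2)) x) = free_rep (Suc N) (spin_mat s j) x"
  unfolding spin_rep_def spin_dim_eq[OF assms(1)]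
proof (rule induced_cls)
  fix y assume y: "y \<in> cls (Uq_rels (s\<^sup>2)) x"
  let ?S = "\<lambda>g. op_of_mat (Suc N) (spin_mat s j g)"
  have "sl2_ops (s\<^sup>2) (?S HE) (?S HF) (?S HK) (?S HKinv)"
    by (rule sl2_ops_spin[OF assms mat_hom_op_of_mat]) simp
  then have "op_ext (word_op ?S) y = op_ext (word_op ?S) x"
    by (intro op_ext_cls[OF monoid_rep_word_op op_ext_Uq_rels y])
  then show "free_rep (Suc N) (spin_mat s j) y = free_rep (Suc N) (spin_mat s j) x"
    by (intro op_of_mat_inj[of _ "Suc N"])
      (simp_all add: op_of_free_rep spin_mat_carrier[OF assms(1)] del: spin_mat.simps)
qed

text \<open>Two representatives are chosen here, one by \<open>ev\<close> and one by
  \<open>spin_rep\<close>. The second choice is harmless by \<open>spin_rep_cls\<close>, the first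
  because the evaluated matrices satisfy the loop relations.\<close>

lemma eval_rep_cls:
  assumes j: "2 * j = real N" and s: "s \<noteq> 0" "s\<^sup>2 \<noteq> inverse (s\<^sup>2)" and "u \<noteq> 0"
  shows "eval_rep s j u (cls (LUq_rels (s\<^sup>2)) x) = free_rep (Suc N) (loop_mat s j u) x"
proof -
  let ?\<psi> = "op_of_mat (Suc N)"
  have h: "mat_hom (Suc N) ?\<psi>" by (rule mat_hom_op_of_mat) simp
  \<comment> \<open>This holds for an arbitrary set \<open>X\<close>, because it concerns only the
    inner choice; the outer one is kept on the right.\<close>
  have eval: "eval_rep s j u X = free_rep (Suc N) (loop_mat s j u) (SOME x. x \<in> X)" for X
  proof (rule op_of_mat_inj[of _ "Suc N"])
    have "?\<psi> (eval_rep s j u X) =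
        op_ext (word_op (\<lambda>g. ?\<psi> (spin_mat s j g))) (free_hom (ev_gen u) (SOME x. x \<in> X))"
      by (simp add: eval_rep_def ev_def induced_def spin_rep_cls[OF j s, unfolded induced_def]
          op_of_free_rep spin_mat_carrier[OF j] del: spin_mat.simps)
    then show "?\<psi> (eval_rep s j u X) = ?\<psi> (free_rep (Suc N) (loop_mat s j u) (SOME x. x \<in> X))"
      by (simp add: op_ext_free_hom monoid_rep_word_op op_ext_ev_gen op_of_free_rep
          loop_mat_carrier[OF j] loop_mat_hom[OF j h])
  qed (simp_all add: eval_rep_def ev_def induced_def spin_rep_cls[OF j s, unfolded induced_def])
  have "eval_rep s j u = induced (free_rep (Suc N) (loop_mat s j u))"
    by (simp add: fun_eq_iff eval induced_def)
  moreover have "free_rep (Suc N) (loop_mat s j u) y = free_rep (Suc N) (loop_mat s j u) x"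
    if y: "y \<in> cls (LUq_rels (s\<^sup>2)) x" for y
  proof -
    have "loop_ops (s\<^sup>2) (\<lambda>g. ?\<psi> (loop_mat s j u g))"
      by (rule loop_ops_loop_mat[OF j h s \<open>u \<noteq> 0\<close>])
    then have "op_ext (word_op (\<lambda>g. ?\<psi> (loop_mat s j u g))) y = op_ext (word_op (\<lambda>g. ?\<psi> (loop_mat s j u g))) x"
      using s by (intro op_ext_cls[OF monoid_rep_word_op op_ext_LUq_rels y]) auto
    then show ?thesis
      by (intro op_of_mat_inj[of _ "Suc N"]) (simp_all add: op_of_free_rep loop_mat_carrier[OF j])
  qed
  ultimately show ?thesis by (simp add: induced_cls)
qed

fun tensor_mat :: "(loop_gen \<Rightarrow> complex mat) \<Rightarrow> (loop_gen \<Rightarrow> complex mat) \<Rightarrow> loop_gen \<Rightarrow> complex mat"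
  where
    "tensor_mat A B (LE i) = kron (A (LE i)) (B (LK i)) + kron (A (LKinv i)) (B (LE i))"
  | "tensor_mat A B (LF i) = kron (A (LF i)) (B (LK i)) + kron (A (LKinv i)) (B (LF i))"
  | "tensor_mat A B (LK i) = kron (A (LK i)) (B (LK i))"
  | "tensor_mat A B (LKinv i) = kron (A (LKinv i)) (B (LKinv i))"

lemma tensor_mat_carrier:
  assumes "\<And>g. A g \<in> carrier_mat n n" "\<And>g. B g \<in> carrier_mat k k"
  shows "tensor_mat A B g \<in> carrier_mat (n * k) (n * k)"
  by (cases g) (simp_all add: kron_carrier[OF assms])

text \<open>That \<open>coproduct\<close> respects the quotients is checked only after applying
  operators: \<open>kill\<close> takes care of the representative in the tensor square,
  \<open>lo\<close> of the one in the loop algebra.\<close>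

lemma tensor_rep_coproduct:
  assumes j: "2 * j = real N" "2 * j' = real N'" and s: "s \<noteq> 0" "s\<^sup>2 \<noteq> inverse (s\<^sup>2)"
    and u: "u \<noteq> 0" "u' \<noteq> 0"
  shows "tensor_rep (s\<^sup>2) (Suc N) (Suc N') (eval_rep s j u) (eval_rep s j' u')
      (coproduct (s\<^sup>2) (cls (LUq_rels (s\<^sup>2)) x)) =
    free_rep (Suc N * Suc N') (tensor_mat (loop_mat s j u) (loop_mat s j' u')) x"
proof -
  define n k where "n = Suc N" and "k = Suc N'"
  have pos: "n > 0" "k > 0" "n * k > 0" by (simp_all add: n_def k_def)
  define A B where "A = loop_mat s j u" and "B = loop_mat s j' u'"
  have carr: "A g \<in> carrier_mat n n" "B g \<in> carrier_mat k k" for g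
    by (simp_all add: A_def B_def n_def k_def loop_mat_carrier[OF j(1)] loop_mat_carrier[OF j(2)])
  define a b where "a = (\<lambda>g. op_of_mat (n * k) (kron (A g) (1\<^sub>m k)))"
    and "b = (\<lambda>g. op_of_mat (n * k) (kron (1\<^sub>m n) (B g)))"
  have L: "loop_ops (s\<^sup>2) a" "loop_ops (s\<^sup>2) b"
    using loop_ops_loop_mat[OF j(1) _ s u(1)] loop_ops_loop_mat[OF j(2) _ s u(2)]
      mat_hom_kron[OF pos(1,2)]
    by (simp_all add: a_def b_def A_def B_def n_def k_def)
  have op_kron: "op_of_mat (n * k) (kron (A g) (B h)) = a g * b h" for g h
    unfolding a_def b_def by (rule op_of_kron(1)[OF carr pos(1,2)])
  have com: "b h * a g = a g * b h" for g h
    using op_of_kron[OF carr pos(1,2)] by (simp add: a_def b_def)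
  define r where "r = (\<lambda>(v, w). word_op a v * word_op b w)"
  have r: "r (v, w) = word_op a v * word_op b w" for v w
    by (simp add: r_def)
  have word_com: "word_op b w * word_op a v = word_op a v * word_op b w" for v w
    using op_of_kron[OF word_mat_carrier word_mat_carrier pos(1,2), of A B, OF carr]
    by (simp add: word_op_mat[OF mat_hom_kron(1)[OF pos(1,2)] carr(1)]
        word_op_mat[OF mat_hom_kron(2)[OF pos(1,2)] carr(2)] a_def b_def)
  \<comment> \<open>In a product of two pairs, \<open>word_op b w\<close> has to pass
    \<open>word_op a v'\<close>; hence \<open>word_com\<close>.\<close>
  have mr: "monoid_rep r"
  proof -
    have "word_op a (v + v') * word_op b (w + w') =
      word_op a v * word_op b w * (word_op a v' * word_op b w')" for v v' w w'
      using monoid_rep_word_op[of a] monoid_rep_word_op[of b] word_com[of w v']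
      by (simp add: monoid_rep_def) (metis mult.assoc)
    then show ?thesis
      using monoid_rep_word_op[of a] monoid_rep_word_op[of b]
      by (auto simp: monoid_rep_def r_def zero_prod_def)
  qed
  let ?T = "\<lambda>(v, w). kron (eval_rep s j u (cls (LUq_rels (s\<^sup>2)) (Poly_Mapping.single v 1)))
           (eval_rep s j' u' (cls (LUq_rels (s\<^sup>2)) (Poly_Mapping.single w 1)))"
  have T: "op_of_mat (n * k) (?T vw) = r vw" for vw
  proof (cases vw)
    case (Pair v w)
    have "?T (v, w) = kron (word_mat n A v) (word_mat k B w)"
      using eval_rep_cls[OF j(1) s u(1)] eval_rep_cls[OF j(2) s u(2)] carr
      by (simp add: free_rep_single A_def B_def n_def k_def)
    then have "op_of_mat (n * k) (?T (v, w)) =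
      op_of_mat (n * k) (kron (word_mat n A v) (1\<^sub>m k)) * op_of_mat (n * k) (kron (1\<^sub>m n) (word_mat k B w))"
      using op_of_kron(1)[OF word_mat_carrier word_mat_carrier pos(1,2), of A B, OF carr] by simp
    also have "\<dots> = r (v, w)"
      by (simp add: word_op_mat[OF mat_hom_kron(1)[OF pos(1,2)] carr(1)]
        word_op_mat[OF mat_hom_kron(2)[OF pos(1,2)] carr(2)] a_def b_def r)
    finally show ?thesis by (simp only: Pair)
  qed
  have ext_T: "op_of_mat (n * k) (mat_lin_ext (n * k) ?T z) = op_ext r z" for z
    unfolding op_of_mat_lin_ext[OF pos(3)] by (rule op_ext_cong) (rule T)
  have kill: "op_ext r z = 0" if "z \<in> LUq_tensor_rels (s\<^sup>2)" for z
    using that s op_ext_LUq_rels[OF L(1)] op_ext_LUq_rels[OF L(2)]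
    by (auto simp: LUq_tensor_rels_def tensor_rels_def op_ext_tens[of r, OF r])
  have tensor_rep: "tensor_rep (s\<^sup>2) n k (eval_rep s j u) (eval_rep s j' u') (cls (LUq_tensor_rels (s\<^sup>2)) z) =
      mat_lin_ext (n * k) ?T z" for z
    unfolding tensor_rep_def
  proof (rule induced_cls)
    fix y assume "y \<in> cls (LUq_tensor_rels (s\<^sup>2)) z"
    then have "op_ext r y = op_ext r z"
      using op_ext_cls[OF mr kill] by blast
    then show "mat_lin_ext (n * k) ?T y = mat_lin_ext (n * k) ?T z"
      by (intro op_of_mat_inj[of _ "n * k"]) (simp_all only: mat_lin_ext_carrier ext_T)
  qed
  have cop: "op_ext r (coproduct_gen g) = coproduct_ops a b g" for g
    by (cases g) (simp_all add: op_ext_add op_ext_tens[of r, OF r])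
  have tm: "op_of_mat (n * k) (tensor_mat A B g) = coproduct_ops a b g" for g
    using mat_hom_op_of_mat[OF pos(3)] kron_carrier[OF carr]
    by (cases g) (simp_all add: op_kron mat_hom_def)
  have lo: "loop_ops (s\<^sup>2) (coproduct_ops a b)"
    using L s com by (intro loop_ops_coproduct) auto
  \<comment> \<open>\<open>y\<close> is the representative to which \<open>coproduct\<close> applies
    \<open>free_hom\<close>; all that is known of it is its class.\<close>
  obtain y where y: "y \<in> cls (LUq_rels (s\<^sup>2)) x"
    and cy: "coproduct (s\<^sup>2) (cls (LUq_rels (s\<^sup>2)) x) =
      cls (LUq_tensor_rels (s\<^sup>2)) (free_hom coproduct_gen y)"
    unfolding coproduct_def induced_def
    using mem_cls_self someI[of "\<lambda>y. y \<in> cls (LUq_rels (s\<^sup>2)) x"] by blast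
  have "op_of_mat (n * k) (mat_lin_ext (n * k) ?T (free_hom coproduct_gen y)) =
      op_ext (word_op (coproduct_ops a b)) y"
    unfolding ext_T by (simp add: op_ext_free_hom[OF mr] cop)
  also have "\<dots> = op_ext (word_op (coproduct_ops a b)) x"
    using s by (intro op_ext_cls[OF monoid_rep_word_op op_ext_LUq_rels[OF lo] y]) auto
  also have "\<dots> = op_of_mat (n * k) (free_rep (n * k) (tensor_mat A B) x)"
    by (simp add: op_of_free_rep[OF pos(3) tensor_mat_carrier[OF carr]] tm)
  finally have "mat_lin_ext (n * k) ?T (free_hom coproduct_gen y) = free_rep (n * k) (tensor_mat A B) x"
    by (intro op_of_mat_inj[of _ "n * k"]) simp_all
  then show ?thesis
    unfolding cy n_def[symmetric] k_def[symmetric] tensor_rep A_def B_def .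
qed

section \<open>Solving the intertwining equations\<close>

text \<open>
  Here \<open>x a c b\<close> is the coefficient of \<open>|1/2, 1/2 - a\<rangle> \<otimes> |j, j - c\<rangle>\<close> in the image of
  \<open>|j + 1/2, j + 1/2 - b\<rangle>\<close>, where \<open>j = N/2\<close>. The raising equations come from \<open>E\<^sub>1\<close> with \<open>T = q\<close> and from
  \<open>F\<^sub>0\<close> with \<open>T = 1/q\<close>, the lowering equations from \<open>F\<^sub>1\<close> with \<open>T = q\<close> and from \<open>E\<^sub>0\<close> with \<open>T = 1/q\<close>.
\<close>

definition raising_eqs :: "complex \<Rightarrow> complex \<Rightarrow> nat \<Rightarrow> (nat \<Rightarrow> nat \<Rightarrow> nat \<Rightarrow> complex) \<Rightarrow> bool"
  where "raising_eqs q T N x \<longleftrightarrow> (\<forall>a<2. \<forall>c\<le>N. \<forall>b\<le>Suc N.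
    (if b = 0 then 0 else ladder q (Suc N) b * x a c (b - 1)) =
    (if a = 0 then T powi (int N - int c) * x 1 c b else 0) +
    (if c < N then T powi (int a - 1) * ladder q N (Suc c) * x a (Suc c) b else 0))"

definition lowering_eqs :: "complex \<Rightarrow> complex \<Rightarrow> nat \<Rightarrow> (nat \<Rightarrow> nat \<Rightarrow> nat \<Rightarrow> complex) \<Rightarrow> bool"
  where "lowering_eqs q T N x \<longleftrightarrow> (\<forall>a<2. \<forall>c\<le>N. \<forall>b\<le>Suc N.
    (if b = Suc N then 0 else ladder q (Suc N) (Suc b) * x a c (Suc b)) =
    (if a = 1 then T powi (- int c) * x 0 c b else 0) +
    (if c > 0 then T powi (int a) * ladder q N c * x a (c - 1) b else 0))"

text \<open>The exponent is the weight of the source vector minus that of the target vector.\<close>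

definition weight_eqs :: "complex \<Rightarrow> nat \<Rightarrow> (nat \<Rightarrow> nat \<Rightarrow> nat \<Rightarrow> complex) \<Rightarrow> bool"
  where "weight_eqs T N x \<longleftrightarrow> (\<forall>a<2. \<forall>c\<le>N. \<forall>b\<le>Suc N.
    T powi (int a + int c - int b) * x a c b = x a c b)"

text \<open>The claimed entries cleared of denominators and without the normalisation. In this form
  the condition is homogeneous in \<open>x\<close>.\<close>

definition fusion_recurrence :: "complex \<Rightarrow> nat \<Rightarrow> (nat \<Rightarrow> nat \<Rightarrow> nat \<Rightarrow> complex) \<Rightarrow> bool"
  where "fusion_recurrence q N x \<longleftrightarrow>
    (\<forall>a<2. \<forall>c\<le>N. \<forall>b\<le>Suc N. a + c \<noteq> b \<longrightarrow> x a c b = 0) \<and>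
    (\<forall>b<N. ladder q (Suc N) (Suc b) * x 0 (Suc b) (Suc b) = ladder q N (Suc b) * x 0 b b) \<and>
    (\<forall>b\<le>N. ladder q (Suc N) (Suc b) * x 1 b (Suc b) = qn q (int (Suc b)) * x 0 b b)"

section \<open>Arithmetic of quantum integers\<close>

lemma not_root_of_unity_powi:
  fixes q :: complex
  assumes "\<forall>n::nat. n > 0 \<longrightarrow> q ^ n \<noteq> 1" "q \<noteq> 0" "q powi k = 1"
  shows "k = 0"
proof (rule ccontr)
  assume "k \<noteq> 0"
  have "q ^ nat \<bar>k\<bar> = 1"
    using assms(2,3) by (cases "k \<ge> 0") (auto simp: power_int_def power_inverse)
  with \<open>k \<noteq> 0\<close> assms(1) show False by simp
qed

lemma qn_nonzero:
  assumes "\<forall>n::nat. n > 0 \<longrightarrow> q ^ n \<noteq> 1" "q \<noteq> 0" "k \<noteq> 0"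
  shows "qn q k \<noteq> 0"
proof -
  have "q powi (2 * l) \<noteq> 1" if "l \<noteq> 0" for l
    using not_root_of_unity_powi[OF assms(1,2), of "2 * l"] that by auto
  moreover have "q powi l = q powi (- l) \<Longrightarrow> q powi (2 * l) = 1" for l
    using assms(2) by (simp add: power_int_minus power_int_mult power2_eq_square field_simps
        mult_2 power_int_add)
  ultimately have "q powi l \<noteq> q powi (- l)" if "l \<noteq> 0" for l
    using that by blast
  from this[of k] this[of 1] show ?thesis
    using assms(3) by (simp add: qn_def power_int_minus)
qed

lemma qn_1: "q \<noteq> inverse q \<Longrightarrow> qn q 1 = 1"
  by (simp add: qn_def power_int_minus)

lemma qn_inverse: "qn (inverse q) k = qn q k"
proof -
  have "qn (inverse q) k = - (q powi k - q powi - k) / - (q - inverse q)"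
    by (simp only: qn_def power_int_inverse power_int_minus inverse_inverse_eq minus_diff_eq)
  then show ?thesis by (simp only: minus_divide_divide qn_def)
qed

text \<open>For k >= 0, [k+1] = q^k + q^(k-2) + ... + q^-k, and here the top term is split
  off.\<close>

lemma qn_Suc:
  assumes "q \<noteq> 0" "q \<noteq> inverse q"
  shows "qn q (k + 1) = q powi k + inverse q * qn q k"
proof -
  define X d where "X = q powi k" and "d = q - inverse q"
  have nz: "X \<noteq> 0" "d \<noteq> 0" using assms by (auto simp: X_def d_def)
  have "q powi (k + 1) = q * X" "q powi (- (k + 1)) = inverse (q * X)" "q powi (- k) = inverse X"
    using assms by (simp_all add: X_def power_int_add power_int_minus power_int_diff field_simps)
  then have "qn q (k + 1) = (q * X - inverse (q * X)) / d" "qn q k = (X - inverse X) / d"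
    by (simp_all add: qn_def X_def d_def)
  moreover have "q * X - inverse (q * X) = X * d + inverse q * (X - inverse X)"
    by (simp add: d_def algebra_simps)
  ultimately show ?thesis
    using nz by (simp add: X_def[symmetric] add_divide_distrib)
qed

text \<open>Splitting off the bottom term instead exchanges q and 1/q. This is why the same
  coefficients satisfy the equations for both values of \<open>T\<close>.\<close>

lemma qn_Suc_sym:
  assumes "q \<noteq> 0" "q \<noteq> inverse q" "T = q \<or> T = inverse q"
  shows "qn q (k + 1) = T powi k + inverse T * qn q k"
  using qn_Suc[OF assms(1,2), of k] qn_Suc[of "inverse q" k] assms
  by (auto simp: qn_inverse)

context
  fixes q :: complex and N :: nat and x :: "nat \<Rightarrow> nat \<Rightarrow> nat \<Rightarrow> complex"
  assumes not_root: "\<forall>n::nat. n > 0 \<longrightarrow> q ^ n \<noteq> 1" and q0: "q \<noteq> 0"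
begin

lemma q_neq_inverse: "q \<noteq> inverse q"
proof
  assume "q = inverse q"
  then have "q ^ 2 = 1" using q0 by (metis power2_eq_square right_inverse)
  then show False using not_root by auto
qed

lemma ladder_nonzero:
  assumes "0 < b" "b \<le> K"
  shows "ladder q K b \<noteq> 0"
  using ladder_square[of q K b] qn_nonzero[OF not_root q0, of "int b"]
    qn_nonzero[OF not_root q0, of "int K + 1 - int b"] assms by force

lemma fusion_recurrence_if_eqs:
  assumes R: "raising_eqs q q N x" "raising_eqs q (inverse q) N x" and K: "weight_eqs q N x"
  shows "fusion_recurrence q N x"
  unfolding fusion_recurrence_def
proof (intro conjI allI impI)
  fix a c b assume "a < (2::nat)" "c \<le> N" "b \<le> Suc N" "a + c \<noteq> b"
  then have "q powi (int a + int c - int b) * x a c b = x a c b"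
    using K unfolding weight_eqs_def by blast
  then show "x a c b = 0"
    using not_root_of_unity_powi[OF not_root q0, of "int a + int c - int b"] \<open>a + c \<noteq> b\<close>
    by auto
next
  define D where "D = ladder q (Suc N)"
  define C where "C = ladder q N"
  have main: "D (Suc b) * x 1 b (Suc b) = qn q (int (Suc b)) * x 0 b b \<and>
      (b < N \<longrightarrow> C (Suc b) * x 0 (Suc b) (Suc b) = qn q (int N - int b) * x 1 b (Suc b))"
    if b: "b \<le> N" for b
  proof -
    \<comment> \<open>For \<open>b = N\<close> the vector \<open>|j, j-b-1>\<close> does not exist;
      the value 0 of \<open>Z\<close> then matches [k] = [0] = 0.\<close>
    define k Y Z where "k = int N - int b" and "Y = x 1 b (Suc b)"
      and "Z = (if b < N then C (Suc b) * x 0 (Suc b) (Suc b) else 0)"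
    have e: "D (Suc b) * x 0 b b = T powi k * Y + inverse T * Z" if "T = q \<or> T = inverse q" for T
    proof -
      have "raising_eqs q T N x" using R that by blast
      from this[unfolded raising_eqs_def, rule_format, of 0 b "Suc b"] b
      show ?thesis by (auto simp: D_def C_def Y_def Z_def k_def power_int_minus mult.assoc)
    qed
    define d where "d = q - inverse q"
    have d: "d \<noteq> 0" using q_neq_inverse by (simp add: d_def)
    \<comment> \<open>Eliminate \<open>x 0 b b\<close> between the equations for T = q and T =
      1/q.\<close>
    have "q powi k * Y + inverse q * Z = q powi (- k) * Y + q * Z"
      using e[of q] e[of "inverse q"] by (simp add: power_int_inverse power_int_minus)
    then have "Z * d = (q powi k - q powi (- k)) * Y"
      by (simp add: d_def algebra_simps)
    then have Z: "Z = qn q k * Y"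
      unfolding qn_def d_def[symmetric] using d by (simp add: eq_divide_eq)
    have "D (Suc b) * x 0 b b = (q powi k + inverse q * qn q k) * Y"
      using e[of q] Z by (simp add: algebra_simps)
    then have DX: "D (Suc b) * x 0 b b = qn q (k + 1) * Y"
      using qn_Suc[OF q0 q_neq_inverse] by simp
    \<comment> \<open>Multiplying \<open>DX\<close> by \<open>D (Suc b)\<close> turns the root into
      its square, which contains the nonzero factor [k+1] to be cancelled.\<close>
    have "D (Suc b) * D (Suc b) = qn q (int (Suc b)) * qn q (k + 1)"
      unfolding D_def ladder_square by (simp add: k_def algebra_simps)
    then have "qn q (k + 1) * (D (Suc b) * Y) = qn q (k + 1) * (qn q (int (Suc b)) * x 0 b b)"
      using DX by (metis mult.assoc mult.commute)
    moreover have "qn q (k + 1) \<noteq> 0"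
      using b by (intro qn_nonzero[OF not_root q0]) (simp add: k_def)
    ultimately show ?thesis
      using Z by (auto simp: Y_def k_def Z_def split: if_splits)
  qed
  fix b
  show "b \<le> N \<Longrightarrow> ladder q (Suc N) (Suc b) * x 1 b (Suc b) = qn q (int (Suc b)) * x 0 b b"
    using main[of b] by (simp add: D_def)
  assume b: "b < N"
  have CC: "C (Suc b) * C (Suc b) = qn q (int (Suc b)) * qn q (int N - int b)"
    unfolding C_def ladder_square by simp
  \<comment> \<open>The extra factor \<open>C (Suc b)\<close> makes \<open>main\<close> applicable
    and produces the square of \<open>C (Suc b)\<close> on the right; then it is cancelled.\<close>
  have "C (Suc b) * (D (Suc b) * x 0 (Suc b) (Suc b)) =
      D (Suc b) * (C (Suc b) * x 0 (Suc b) (Suc b))"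
    by simp
  also have "\<dots> = qn q (int N - int b) * (D (Suc b) * x 1 b (Suc b))"
    using main[of b] b by simp
  also have "\<dots> = qn q (int (Suc b)) * qn q (int N - int b) * x 0 b b"
    using main[of b] b by simp
  finally have "C (Suc b) * (D (Suc b) * x 0 (Suc b) (Suc b)) = C (Suc b) * (C (Suc b) * x 0 b b)"
    using CC by (simp flip: mult.assoc)
  then show "ladder q (Suc N) (Suc b) * x 0 (Suc b) (Suc b) = ladder q N (Suc b) * x 0 b b"
    using ladder_nonzero[of "Suc b" N] b by (simp add: C_def D_def)
qed

text \<open>The recurrence involves q only through quantum integers, which are invariant under q ->
  1/q, so both values of \<open>T\<close> are treated at once.\<close>

lemma
  assumes F: "fusion_recurrence q N x" and T: "T = q \<or> T = inverse q"
  shows fusion_recurrence_raising: "raising_eqs q T N x"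
    and fusion_recurrence_lowering: "lowering_eqs q T N x"
    and fusion_recurrence_weight: "weight_eqs T N x"
proof -
  define D where "D = ladder q (Suc N)"
  define C where "C = ladder q N"
  have T0: "T \<noteq> 0" using T q0 by auto
  have off: "x a c b = 0" if "a < 2" "c \<le> N" "b \<le> Suc N" "a + c \<noteq> b" for a c b
    using F that unfolding fusion_recurrence_def by blast
  have X: "D (Suc b) * x 0 (Suc b) (Suc b) = C (Suc b) * x 0 b b" if "b < N" for b
    using F that unfolding fusion_recurrence_def D_def C_def by blast
  have Y: "D (Suc b) * x 1 b (Suc b) = qn q (int (Suc b)) * x 0 b b" if "b \<le> N" for b
    using F that unfolding fusion_recurrence_def D_def by blast
  have D0: "D (Suc b) \<noteq> 0" if "b \<le> N" for b
    using ladder_nonzero[of "Suc b" "Suc N"] that by (simp add: D_def)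
  have CC: "C (Suc b) * C (Suc b) = qn q (int (Suc b)) * qn q (int N - int b)" for b
    unfolding C_def ladder_square by simp
  have DD: "D (Suc b) * D (Suc b) = qn q (int (Suc b)) * qn q (int N - int b + 1)" for b
    unfolding D_def ladder_square by (simp add: algebra_simps)
  \<comment> \<open>\<open>CX\<close>, \<open>DX\<close> and \<open>CY\<close> trade a ladder factor
    for a quantum integer. Each is proved after multiplication by the nonzero
    \<open>D (Suc b)\<close>; at \<open>b = N\<close>, \<open>CX\<close> reads 0 = 0.\<close>
  have CX: "C (Suc b) * x 0 (Suc b) (Suc b) = qn q (int N - int b) * x 1 b (Suc b)" if "b \<le> N" for b
  proof (cases "b = N")
    case False
    with that have "D (Suc b) * (C (Suc b) * x 0 (Suc b) (Suc b)) = 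
        D (Suc b) * (qn q (int N - int b) * x 1 b (Suc b))"
      using X[of b] Y[of b] CC[of b] by (simp add: mult.left_commute[of "D _"])
    then show ?thesis using D0[OF that] by simp
  qed (simp add: C_def)
  have DX: "D (Suc b) * x 0 b b = qn q (int N - int b + 1) * x 1 b (Suc b)" if "b \<le> N" for b
  proof -
    have "D (Suc b) * (D (Suc b) * x 0 b b) = D (Suc b) * (qn q (int N - int b + 1) * x 1 b (Suc b))"
      using Y[OF that] DD[of b] by (metis mult.assoc mult.commute)
    then show ?thesis using D0[OF that] by simp
  qed
  have CY: "C (Suc b) * x 1 b (Suc b) = qn q (int (Suc b)) * x 0 (Suc b) (Suc b)" if "b < N" for b
  proof -
    have "D (Suc b) * (C (Suc b) * x 1 b (Suc b)) = D (Suc b) * (qn q (int (Suc b)) * x 0 (Suc b) (Suc b))"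
      using X[OF that] Y[of b] that by (metis less_imp_le mult.assoc mult.commute)
    then show ?thesis using D0[of b] that by simp
  qed
  show "weight_eqs T N x"
    unfolding weight_eqs_def
  proof (intro allI impI)
    fix a c b assume *: "a < (2::nat)" "c \<le> N" "b \<le> Suc N"
    show "T powi (int a + int c - int b) * x a c b = x a c b"
      using off[OF *] by (cases "a + c = b") (auto simp flip: of_nat_add)
  qed
  show "raising_eqs q T N x"
    unfolding raising_eqs_def D_def[symmetric] C_def[symmetric]
  proof (intro allI impI)
    fix a c b assume *: "a < (2::nat)" "c \<le> N" "b \<le> Suc N"
    show "(if b = 0 then 0 else D b * x a c (b - 1)) =
      (if a = 0 then T powi (int N - int c) * x 1 c b else 0) +
      (if c < N then T powi (int a - 1) * C (Suc c) * x a (Suc c) b else 0)"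
    \<comment> \<open>Raising preserves weights up to the shift by one: off this line every
      coefficient in the equation vanishes.\<close>
    proof (cases "a + Suc c = b")
      case False
      then show ?thesis using * by (auto simp: off)
    next
      case b: True
      show ?thesis
      proof (cases "a = 0")
        case True
        have "D (Suc c) * x 0 c c = (T powi (int N - int c) + inverse T * qn q (int N - int c)) * x 1 c (Suc c)"
          using DX[OF *(2)] qn_Suc_sym[OF q0 q_neq_inverse T] by simp
        also have "\<dots> = T powi (int N - int c) * x 1 c (Suc c) + inverse T * (C (Suc c) * x 0 (Suc c) (Suc c))"
          unfolding CX[OF *(2)] by (simp add: algebra_simps)
        finally show ?thesis
          using True b * by (auto simp: power_int_minus C_def)
      next
        case False
        with * b have a: "a = 1" "b = Suc (Suc c)" "c < N" by auto
        \<comment> \<open>Multiply by \<open>C (Suc c)\<close>: \<open>CY\<close> leads to the upper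
          coefficient, \<open>DX\<close> back to the lower one, and the quantum integers gathered
          are the square of \<open>C (Suc c)\<close>.\<close>
        have "D (Suc (Suc c)) * x 1 c (Suc c) = C (Suc c) * x 1 (Suc c) (Suc (Suc c))"
        proof -
          have "C (Suc c) * (D (Suc (Suc c)) * x 1 c (Suc c)) =
              qn q (int (Suc c)) * (D (Suc (Suc c)) * x 0 (Suc c) (Suc c))"
            using CY[OF a(3)] by (metis mult.left_commute)
          also have "\<dots> = qn q (int (Suc c)) * qn q (int N - int c) * x 1 (Suc c) (Suc (Suc c))"
            using DX[of "Suc c"] a by simp
          also have "\<dots> = C (Suc c) * (C (Suc c) * x 1 (Suc c) (Suc (Suc c)))"
            using CC[of c] by (metis mult.assoc)
          finally show ?thesis
            using ladder_nonzero[of "Suc c" N] a by (simp add: C_def)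
        qed
        then show ?thesis using a by simp
      qed
    qed
  qed
  show "lowering_eqs q T N x"
    unfolding lowering_eqs_def D_def[symmetric] C_def[symmetric]
  proof (intro allI impI)
    fix a c b assume *: "a < (2::nat)" "c \<le> N" "b \<le> Suc N"
    show "(if b = Suc N then 0 else D (Suc b) * x a c (Suc b)) =
      (if a = 1 then T powi (- int c) * x 0 c b else 0) +
      (if c > 0 then T powi (int a) * C c * x a (c - 1) b else 0)"
    proof (cases "a + c = Suc b")
      case False
      then show ?thesis using * by (auto simp: off)
    next
      case b: True
      show ?thesis
      proof (cases "a = 0")
        case True
        then show ?thesis using X[of b] b * by auto
      next
        case False
        with * b have a: "a = 1" "b = c" by auto
        \<comment> \<open>Lowering carries the opposite power of \<open>T\<close>, so [c+1] is split
          with \<open>inverse T\<close>.\<close>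
        have "D (Suc c) * x 1 c (Suc c) = (T powi (- int c) + T * qn q (int c)) * x 0 c c"
          using Y[OF *(2)] qn_Suc_sym[OF q0 q_neq_inverse, of "inverse T" "int c"] T
          by (auto simp: power_int_inverse power_int_minus power_inverse add.commute)
        moreover have "qn q (int c) * x 0 c c = (if c > 0 then C c * x 1 (c - 1) c else 0)"
          using CY[of "c - 1"] * by (cases c) auto
        ultimately show ?thesis using a * by (auto simp: algebra_simps)
      qed
    qed
  qed
qed

end

section \<open>Intertwiners on generators\<close>

lemma index_mat_mult_sum:
  assumes "A \<in> carrier_mat n m" "B \<in> carrier_mat m k" "i < n" "j < k"
  shows "(A * B) $$ (i, j) = (\<Sum>l<m. A $$ (i, l) * B $$ (l, j))"
  using assms by (simp add: scalar_prod_def lessThan_atLeast0)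

lemma mat_lin_ext_intertwine:
  assumes M: "M \<in> carrier_mat m n"
    and f: "\<And>w. f w \<in> carrier_mat n n" and g: "\<And>w. g w \<in> carrier_mat m m"
    and fg: "\<And>w. M * f w = g w * M"
  shows "M * mat_lin_ext n f x = mat_lin_ext m g x * M"
proof (rule eq_matI)
  fix i j assume "i < dim_row (mat_lin_ext m g x * M)" "j < dim_col (mat_lin_ext m g x * M)"
  then have ij: "i < m" "j < n" using M by (auto simp: mat_lin_ext_def)
  let ?K = "Poly_Mapping.keys x" and ?c = "Poly_Mapping.lookup x"
  have "(M * mat_lin_ext n f x) $$ (i, j) = (\<Sum>l<n. \<Sum>w\<in>?K. ?c w * (M $$ (i, l) * f w $$ (l, j)))"
    using ij by (subst index_mat_mult_sum[OF M mat_lin_ext_carrier])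
      (simp_all add: mat_lin_ext_def sum_distrib_left mult_ac)
  also have "\<dots> = (\<Sum>w\<in>?K. ?c w * (M * f w) $$ (i, j))"
    using ij by (subst sum.swap) (simp add: index_mat_mult_sum[OF M f] sum_distrib_left)
  also have "\<dots> = (\<Sum>l<m. \<Sum>w\<in>?K. ?c w * (g w $$ (i, l) * M $$ (l, j)))"
    unfolding fg using ij by (subst sum.swap) (simp add: index_mat_mult_sum[OF g M] sum_distrib_left)
  also have "\<dots> = (mat_lin_ext m g x * M) $$ (i, j)"
    using ij by (subst index_mat_mult_sum[OF mat_lin_ext_carrier M])
      (simp_all add: mat_lin_ext_def sum_distrib_left mult_ac)
  finally show "(M * mat_lin_ext n f x) $$ (i, j) = (mat_lin_ext m g x * M) $$ (i, j)" .
qed (use M in \<open>auto simp: mat_lin_ext_def\<close>)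

lemma word_mat_intertwine:
  assumes M: "M \<in> carrier_mat m n"
    and A: "\<And>g. A g \<in> carrier_mat n n" and B: "\<And>g. B g \<in> carrier_mat m m"
    and AB: "\<And>g. M * A g = B g * M"
  shows "M * word_mat n A w = word_mat m B w * M"
proof -
  have "M * word_mat n A (Letters gs) = word_mat m B (Letters gs) * M" for gs
  proof (induction gs)
    case Nil
    show ?case using M by (simp add: word_mat_def)
  next
    case (Cons g gs)
    have W: "word_mat n A (Letters gs) \<in> carrier_mat n n" "word_mat m B (Letters gs) \<in> carrier_mat m m"
      using A B by (simp_all add: word_mat_carrier)
    have "M * word_mat n A (Letters (g # gs)) = M * A g * word_mat n A (Letters gs)"
      using assoc_mult_mat[OF M A W(1)] by (simp add: word_mat_def)
    also have "\<dots> = B g * (word_mat m B (Letters gs) * M)"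
      unfolding AB assoc_mult_mat[OF B M W(1)] Cons ..
    also have "\<dots> = word_mat m B (Letters (g # gs)) * M"
      using assoc_mult_mat[OF B W(2) M] by (simp add: word_mat_def)
    finally show ?case .
  qed
  then show ?thesis by (cases w) simp
qed

lemma is_LUq_intertwiner_iff:
  assumes j: "2 * j = real N" and s: "s \<noteq> 0" "s\<^sup>2 \<noteq> inverse (s\<^sup>2)"
    and u: "u \<noteq> 0" "u1 \<noteq> 0" "u2 \<noteq> 0"
    and M: "M \<in> carrier_mat (2 * Suc N) (Suc (Suc N))"
  shows "is_LUq_intertwiner s j u u1 u2 M \<longleftrightarrow>
    (\<forall>g. M * loop_mat s (j + 1/2) u g = tensor_mat (loop_mat s (1/2) u1) (loop_mat s j u2) g * M)"
proof -
  have j': "2 * (j + 1/2) = real (Suc N)" and h: "2 * (1/2) = real (Suc 0)"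
    using j by simp_all
  have dim: "2 * Suc N = Suc (Suc 0) * Suc N" by simp
  define A B where "A = loop_mat s (j + 1/2) u"
    and "B = tensor_mat (loop_mat s (1/2) u1) (loop_mat s j u2)"
  have A: "A g \<in> carrier_mat (Suc (Suc N)) (Suc (Suc N))" for g
    unfolding A_def by (rule loop_mat_carrier[OF j'])
  have B: "B g \<in> carrier_mat (2 * Suc N) (2 * Suc N)" for g
    unfolding B_def dim
    by (rule tensor_mat_carrier[OF loop_mat_carrier[OF h] loop_mat_carrier[OF j]])
  have "carrier (LUq (s\<^sup>2)) = range (cls (LUq_rels (s\<^sup>2)))"
    by (simp add: LUq_def carrier_presented)
  moreover have "tensor_rep (s\<^sup>2) (Suc (Suc 0)) (Suc N) (eval_rep s (1/2) u1) (eval_rep s j u2)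
      (coproduct (s\<^sup>2) (cls (LUq_rels (s\<^sup>2)) x)) = free_rep (2 * Suc N) B x" for x
    unfolding tensor_rep_coproduct[OF h j s u(2,3)] B_def dim ..
  ultimately have *: "is_LUq_intertwiner s j u u1 u2 M \<longleftrightarrow>
      (\<forall>x. M * free_rep (Suc (Suc N)) A x = free_rep (2 * Suc N) B x * M)"
    by (simp add: is_LUq_intertwiner_def eval_rep_cls[OF j' s u(1)] A_def spin_dim_eq[OF j]
        spin_dim_eq[OF h])
  show ?thesis
    unfolding * A_def[symmetric] B_def[symmetric]
  proof (intro iffI allI)
    fix g assume "\<forall>x. M * free_rep (Suc (Suc N)) A x = free_rep (2 * Suc N) B x * M"
    then have "M * free_rep (Suc (Suc N)) A (gen g) = free_rep (2 * Suc N) B (gen g) * M" by blast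
    then show "M * A g = B g * M" using A B by (simp add: free_rep_gen del: mult_Suc_right)
  next
    fix x assume "\<forall>g. M * A g = B g * M"
    then show "M * free_rep (Suc (Suc N)) A x = free_rep (2 * Suc N) B x * M"
      unfolding free_rep_eq
      using A B by (intro mat_lin_ext_intertwine[OF M] word_mat_intertwine[OF M] word_mat_carrier) auto
  qed
qed

section \<open>The generator equations entry by entry\<close>

lemma kron_mult_entry:
  assumes "A \<in> carrier_mat n n" "B \<in> carrier_mat k k" "M \<in> carrier_mat (n * k) m"
    and "a < n" "c < k" "b < m"
  shows "(kron A B * M) $$ (a * k + c, b) =
    (\<Sum>a'<n. A $$ (a, a') * (\<Sum>c'<k. B $$ (c, c') * M $$ (a' * k + c', b)))"
proof -
  have i: "a * k + c < n * k"
    using assms(4,5) by (metis add_less_cancel_left less_le_trans mult_Suc mult_le_mono1 Suc_leI add.commute)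
  have "(kron A B * M) $$ (a * k + c, b) =
      (\<Sum>l<n * k. A $$ (a, l div k) * B $$ (c, l mod k) * M $$ (l div k * k + l mod k, b))"
    using assms i by (subst index_mat_mult_sum[OF kron_carrier assms(3)]) (auto simp: kron_def)
  also have "\<dots> = (\<Sum>a'<n. \<Sum>c'<k. A $$ (a, a') * B $$ (c, c') * M $$ (a' * k + c', b))"
    by (rule sum_div_mod)
  finally show ?thesis by (simp add: sum_distrib_left mult.assoc)
qed

lemma mat_eq_iff_entries:
  assumes "P \<in> carrier_mat (n * k) m" "Q \<in> carrier_mat (n * k) m"
  shows "P = Q \<longleftrightarrow> (\<forall>a<n. \<forall>c<k. \<forall>b<m. P $$ (a * k + c, b) = Q $$ (a * k + c, b))"
proof (intro iffI)
  assume *: "\<forall>a<n. \<forall>c<k. \<forall>b<m. P $$ (a * k + c, b) = Q $$ (a * k + c, b)"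
  show "P = Q"
  proof (rule eq_matI)
    fix i b assume "i < dim_row Q" "b < dim_col Q"
    then have i: "i < n * k" "b < m" using assms by auto
    then have "k > 0" by (cases k) auto
    with i have "i div k < n" "i mod k < k" by (auto simp: less_mult_imp_div_less)
    from *[rule_format, OF this i(2)] show "P $$ (i, b) = Q $$ (i, b)" by simp
  qed (use assms in auto)
qed simp

definition block :: "nat \<Rightarrow> complex mat \<Rightarrow> nat \<Rightarrow> nat \<Rightarrow> nat \<Rightarrow> complex"
  where "block N M a c b = M $$ (a * Suc N + c, b)"

lemma row_less: "a < 2 \<Longrightarrow> c \<le> N \<Longrightarrow> a * Suc N + c < 2 * Suc N"
  by (auto simp: numeral_2_eq_2 less_Suc_eq)

lemma kron_smult:
  "kron (c \<cdot>\<^sub>m A) B = c \<cdot>\<^sub>m kron A B" "kron A (c \<cdot>\<^sub>m B) = c \<cdot>\<^sub>m kron A B"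
  by (rule eq_matI; cases "dim_row B = 0"; cases "dim_col B = 0";
      auto simp: kron_def less_mult_imp_div_less)+

lemma tensor_sum_mult_entry:
  assumes "A \<in> carrier_mat n n" "A' \<in> carrier_mat n n" "B \<in> carrier_mat k k" "B' \<in> carrier_mat k k"
    and "M \<in> carrier_mat (n * k) m" "i < n * k" "b < m"
  shows "((kron (\<alpha> \<cdot>\<^sub>m A) B + kron A' (\<beta> \<cdot>\<^sub>m B')) * M) $$ (i, b) =
    \<alpha> * (kron A B * M) $$ (i, b) + \<beta> * (kron A' B' * M) $$ (i, b)"
proof -
  have c: "kron A B \<in> carrier_mat (n * k) (n * k)" "kron A' B' \<in> carrier_mat (n * k) (n * k)"
    using assms by auto
  then have "(kron (\<alpha> \<cdot>\<^sub>m A) B + kron A' (\<beta> \<cdot>\<^sub>m B')) * M =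
      \<alpha> \<cdot>\<^sub>m (kron A B * M) + \<beta> \<cdot>\<^sub>m (kron A' B' * M)"
    using assms(5) unfolding kron_smult
    by (subst add_mult_distrib_mat[of _ "n * k" "n * k"]) auto
  then show ?thesis using c assms(5-) by auto
qed

context
  fixes s u u1 u2 :: complex and N :: nat and M :: "complex mat" and j :: real
  assumes j: "2 * j = real N" and s: "s \<noteq> 0" "s\<^sup>2 \<noteq> inverse (s\<^sup>2)" and u: "u \<noteq> 0"
    and u1: "u1 = u * s powi (- int N)" and u2: "u2 = u * s"
    and M: "M \<in> carrier_mat (2 * Suc N) (Suc (Suc N))"
begin

lemma source_spins: "2 * (j + 1/2) = real (Suc N)" "2 * (1/2) = real (Suc 0)"
  using j by simp_all

text \<open>Here the choice of the root counts: \<open>csqrt 1 = 1\<close> makes E and F of spin 1/2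
  the two off-diagonal matrix units.\<close>

lemma ladder_1_1: "ladder (s\<^sup>2) (Suc 0) (Suc 0) = 1"
  using qn_1[OF s(2)] by (simp add: ladder_def)

lemmas delta_simps = if_distrib[of "\<lambda>x. x * _"] if_distrib[of "\<lambda>x. _ * x"] sum.delta sum.delta'

lemma source_entry:
  assumes "r < 2 * Suc N" "b \<le> Suc N"
  shows "(M * spin_mat s (j + 1/2) HE) $$ (r, b) =
      (if b = 0 then 0 else ladder (s\<^sup>2) (Suc N) b * M $$ (r, b - 1))"
    and "(M * spin_mat s (j + 1/2) HF) $$ (r, b) =
      (if b = Suc N then 0 else ladder (s\<^sup>2) (Suc N) (Suc b) * M $$ (r, Suc b))"
    and "(M * spin_mat s (j + 1/2) HK) $$ (r, b) = s powi (int (Suc N) - 2 * int b) * M $$ (r, b)"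
    and "(M * spin_mat s (j + 1/2) HKinv) $$ (r, b) = s powi (2 * int b - int (Suc N)) * M $$ (r, b)"
  using assms unfolding spin_mat_eq[OF source_spins(1)]
  by (subst index_mat_mult_sum[OF M, where k = "Suc (Suc N)"];
      cases b; auto simp: delta_simps mult.commute simp del: sum.lessThan_Suc of_nat_Suc cong: if_cong)+

lemma half_entry:
  assumes "a < 2" "a' < 2"
  shows "spin_mat s (1/2) HE $$ (a, a') = (if a = 0 \<and> a' = 1 then 1 else 0)"
    and "spin_mat s (1/2) HF $$ (a, a') = (if a = 1 \<and> a' = 0 then 1 else 0)"
    and "spin_mat s (1/2) HK $$ (a, a') = (if a = a' then s powi (1 - 2 * int a) else 0)"
    and "spin_mat s (1/2) HKinv $$ (a, a') = (if a = a' then s powi (2 * int a - 1) else 0)"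
  unfolding spin_mat_eq[OF source_spins(2)]
  using assms ladder_1_1 by (auto simp: numeral_2_eq_2 less_Suc_eq simp del: power_Suc)

lemma target_entry:
  assumes "a < 2" "c \<le> N" "b \<le> Suc N" "B \<in> carrier_mat (Suc N) (Suc N)"
  shows "(kron (spin_mat s (1/2) HE) B * M) $$ (a * Suc N + c, b) =
      (if a = 0 then (\<Sum>c'<Suc N. B $$ (c, c') * block N M 1 c' b) else 0)"
    and "(kron (spin_mat s (1/2) HF) B * M) $$ (a * Suc N + c, b) =
      (if a = 1 then (\<Sum>c'<Suc N. B $$ (c, c') * block N M 0 c' b) else 0)"
    and "(kron (spin_mat s (1/2) HK) B * M) $$ (a * Suc N + c, b) =
      s powi (1 - 2 * int a) * (\<Sum>c'<Suc N. B $$ (c, c') * block N M a c' b)"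
    and "(kron (spin_mat s (1/2) HKinv) B * M) $$ (a * Suc N + c, b) =
      s powi (2 * int a - 1) * (\<Sum>c'<Suc N. B $$ (c, c') * block N M a c' b)"
proof -
  have carr: "spin_mat s (1/2) g \<in> carrier_mat 2 2" for g
    using spin_mat_carrier[OF source_spins(2)] by (simp add: numeral_2_eq_2)
  have sum2: "(\<Sum>a<2. f a) = f 0 + f 1" for f :: "nat \<Rightarrow> complex"
    by (simp add: numeral_2_eq_2)
  have "(kron (spin_mat s (1/2) g) B * M) $$ (a * Suc N + c, b) =
      spin_mat s (1/2) g $$ (a, 0) * (\<Sum>c'<Suc N. B $$ (c, c') * block N M 0 c' b) +
      spin_mat s (1/2) g $$ (a, 1) * (\<Sum>c'<Suc N. B $$ (c, c') * block N M 1 c' b)" for g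
    using assms by (subst kron_mult_entry[OF carr assms(4) M]) (simp_all only: sum2 less_Suc_eq_le block_def)
  moreover have "a = 0 \<or> a = 1" using assms(1) by auto
  ultimately show "(kron (spin_mat s (1/2) HE) B * M) $$ (a * Suc N + c, b) =
      (if a = 0 then (\<Sum>c'<Suc N. B $$ (c, c') * block N M 1 c' b) else 0)"
    "(kron (spin_mat s (1/2) HF) B * M) $$ (a * Suc N + c, b) =
      (if a = 1 then (\<Sum>c'<Suc N. B $$ (c, c') * block N M 0 c' b) else 0)"
    "(kron (spin_mat s (1/2) HK) B * M) $$ (a * Suc N + c, b) =
      s powi (1 - 2 * int a) * (\<Sum>c'<Suc N. B $$ (c, c') * block N M a c' b)"
    "(kron (spin_mat s (1/2) HKinv) B * M) $$ (a * Suc N + c, b) =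
      s powi (2 * int a - 1) * (\<Sum>c'<Suc N. B $$ (c, c') * block N M a c' b)"
    by (auto simp: half_entry simp del: spin_mat.simps sum.lessThan_Suc)
qed

lemma spin_entry:
  fixes f :: "nat \<Rightarrow> complex"
  assumes "c \<le> N"
  shows "(\<Sum>c'<Suc N. spin_mat s j HE $$ (c, c') * f c') =
      (if c < N then ladder (s\<^sup>2) N (Suc c) * f (Suc c) else 0)"
    and "(\<Sum>c'<Suc N. spin_mat s j HF $$ (c, c') * f c') =
      (if c > 0 then ladder (s\<^sup>2) N c * f (c - 1) else 0)"
    and "(\<Sum>c'<Suc N. spin_mat s j HK $$ (c, c') * f c') = s powi (int N - 2 * int c) * f c"
    and "(\<Sum>c'<Suc N. spin_mat s j HKinv $$ (c, c') * f c') = s powi (2 * int c - int N) * f c"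
  using assms unfolding spin_mat_eq[OF j]
  by (cases c; auto simp: delta_simps simp del: sum.lessThan_Suc cong: if_cong)+

lemma source_entry_smult:
  assumes "r < 2 * Suc N" "b \<le> Suc N"
  shows "(M * (\<gamma> \<cdot>\<^sub>m spin_mat s (j + 1/2) g)) $$ (r, b) = \<gamma> * (M * spin_mat s (j + 1/2) g) $$ (r, b)"
proof -
  have "M * (\<gamma> \<cdot>\<^sub>m spin_mat s (j + 1/2) g) = \<gamma> \<cdot>\<^sub>m (M * spin_mat s (j + 1/2) g)"
    by (rule mult_smult_distrib[OF M spin_mat_carrier[OF source_spins(1)]])
  then show ?thesis
    using assms M spin_mat_carrier[OF source_spins(1), of s g] by (simp del: spin_mat.simps)
qed

lemma powi_q: "s\<^sup>2 powi k = s powi (2 * k)" "inverse (s\<^sup>2) powi k = s powi (- (2 * k))"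
  by (simp_all add: power_int_mult power_int_inverse power_int_minus)

text \<open>The place where the values of \<open>u1\<close> and \<open>u2\<close> enter: they become
  \<open>u\<close> times a power of \<open>s\<close>, and that power merges with the Cartan
  eigenvalues.\<close>

lemma scalar_simps:
  "inverse u1 * s powi k = inverse u * s powi (k + int N)"
  "u1 * s powi k = u * s powi (k - int N)"
  "inverse u2 * s powi k = inverse u * s powi (k - 1)"
  "u2 * s powi k = u * s powi (k + 1)"
  using s(1) by (simp_all add: u1 u2 power_int_add power_int_diff power_int_minus divide_inverse)

lemmas scalar_assoc_simps = scalar_simps[THEN arg_cong[where f = "\<lambda>z. z * y" for y], simplified mult.assoc]

lemma spin_block_carrier:
  "spin_mat s (1/2) g \<in> carrier_mat 2 2" "spin_mat s j g \<in> carrier_mat (Suc N) (Suc N)"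
  using spin_mat_carrier[OF source_spins(2)] spin_mat_carrier[OF j] by (simp_all only: numeral_2_eq_2)

lemma generator_eqs:
  defines "L \<equiv> loop_mat s (j + 1/2) u" and "T \<equiv> tensor_mat (loop_mat s (1/2) u1) (loop_mat s j u2)"
  shows "M * L (LE N1) = T (LE N1) * M \<longleftrightarrow> raising_eqs (s\<^sup>2) (s\<^sup>2) N (block N M)"
    and "M * L (LF N0) = T (LF N0) * M \<longleftrightarrow> raising_eqs (s\<^sup>2) (inverse (s\<^sup>2)) N (block N M)"
    and "M * L (LF N1) = T (LF N1) * M \<longleftrightarrow> lowering_eqs (s\<^sup>2) (s\<^sup>2) N (block N M)"
    and "M * L (LE N0) = T (LE N0) * M \<longleftrightarrow> lowering_eqs (s\<^sup>2) (inverse (s\<^sup>2)) N (block N M)"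
    and "M * L (LK i) = T (LK i) * M \<longleftrightarrow> weight_eqs (if i = N0 then s\<^sup>2 else inverse (s\<^sup>2)) N (block N M)"
    and "M * L (LKinv i) = T (LKinv i) * M \<longleftrightarrow> weight_eqs (if i = N1 then s\<^sup>2 else inverse (s\<^sup>2)) N (block N M)"
proof -
  have eq: "M * L g = T g * M \<longleftrightarrow> (\<forall>a<2. \<forall>c\<le>N. \<forall>b\<le>Suc N.
      (M * L g) $$ (a * Suc N + c, b) = (T g * M) $$ (a * Suc N + c, b))" for g
  proof -
    have "L g \<in> carrier_mat (Suc (Suc N)) (Suc (Suc N))"
      unfolding L_def by (rule loop_mat_carrier[OF source_spins(1)])
    moreover have "T g \<in> carrier_mat (2 * Suc N) (2 * Suc N)"
      unfolding T_def
      by (rule tensor_mat_carrier)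
        (use loop_mat_carrier[OF source_spins(2)] loop_mat_carrier[OF j] in \<open>simp_all only: numeral_2_eq_2\<close>)
    ultimately show ?thesis
      using M by (subst mat_eq_iff_entries[of _ 2 "Suc N" "Suc (Suc N)"])
        (auto simp: less_Suc_eq_le simp del: mult_Suc mult_Suc_right)
  qed
  \<comment> \<open>The common factor \<open>c\<close> will be \<open>u\<close> or its inverse for E
    and F, and the Cartan eigenvalue of the source vector for K.\<close>
  have cancel: "v = v' \<longleftrightarrow> w = w'" if "v = c * w" "v' = c * w'" "c \<noteq> 0" for v v' w w' c :: complex
    using that by auto
  define R where "R T a c b \<longleftrightarrow> (if b = 0 then 0 else ladder (s\<^sup>2) (Suc N) b * block N M a c (b - 1)) =
      (if a = 0 then T powi (int N - int c) * block N M 1 c b else 0) +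
      (if c < N then T powi (int a - 1) * ladder (s\<^sup>2) N (Suc c) * block N M a (Suc c) b else 0)" for T a c b
  define S where "S T a c b \<longleftrightarrow>
      (if b = Suc N then 0 else ladder (s\<^sup>2) (Suc N) (Suc b) * block N M a c (Suc b)) =
      (if a = 1 then T powi (- int c) * block N M 0 c b else 0) +
      (if c > 0 then T powi (int a) * ladder (s\<^sup>2) N c * block N M a (c - 1) b else 0)" for T a c b
  define W where "W T a c b \<longleftrightarrow> T powi (int a + int c - int b) * block N M a c b = block N M a c b" for T a c b
  let ?q = "s\<^sup>2"
  let ?eq = "\<lambda>g a c b. (M * L g) $$ (a * Suc N + c, b) = (T g * M) $$ (a * Suc N + c, b)"
  have entries:
    "?eq (LE N1) a c b \<longleftrightarrow> R ?q a c b"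
    "?eq (LF N0) a c b \<longleftrightarrow> R (inverse ?q) a c b"
    "?eq (LF N1) a c b \<longleftrightarrow> S ?q a c b"
    "?eq (LE N0) a c b \<longleftrightarrow> S (inverse ?q) a c b"
    "?eq (LK N0) a c b \<longleftrightarrow> W ?q a c b"
    "?eq (LK N1) a c b \<longleftrightarrow> W (inverse ?q) a c b"
    "?eq (LKinv N0) a c b \<longleftrightarrow> W (inverse ?q) a c b"
    "?eq (LKinv N1) a c b \<longleftrightarrow> W ?q a c b"
    if abc: "a < 2" "c \<le> N" "b \<le> Suc N" for a c b
  proof -
    note row = row_less[OF abc(1,2)]
    have b: "b < Suc (Suc N)" using abc(3) by simp
    note unf = L_def T_def loop_mat.simps tensor_mat.simps source_entry_smult[OF row abc(3)]
      source_entry[OF row abc(3), folded block_def[of N M]]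
      tensor_sum_mult_entry[OF spin_block_carrier(1,1,2,2) M row b]
      target_entry[OF abc spin_block_carrier(2)] spin_entry[OF abc(2)]
    note scalars = scalar_simps scalar_assoc_simps powi_q distrib_left mult.assoc
    show "?eq (LE N1) a c b \<longleftrightarrow> R ?q a c b"
      unfolding unf R_def using u
      by (intro cancel[where c = "inverse u"]) (auto simp: scalars algebra_simps simp del: power_int_of_nat)
    show "?eq (LF N0) a c b \<longleftrightarrow> R (inverse ?q) a c b"
      unfolding unf R_def using u
      by (intro cancel[where c = "u"]) (auto simp: scalars algebra_simps simp del: power_int_of_nat)
    show "?eq (LF N1) a c b \<longleftrightarrow> S ?q a c b"
      unfolding unf S_def using u
      by (intro cancel[where c = "u"]) (auto simp: scalars algebra_simps simp del: power_int_of_nat)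
    show "?eq (LE N0) a c b \<longleftrightarrow> S (inverse ?q) a c b"
      unfolding unf S_def using u
      by (intro cancel[where c = "inverse u"]) (auto simp: scalars algebra_simps simp del: power_int_of_nat)
    \<comment> \<open>\<open>W\<close> is turned around because the source side is the eigenvalue
      times the bare coefficient.\<close>
    show "?eq (LK N0) a c b \<longleftrightarrow> W ?q a c b"
      unfolding unf W_def eq_commute[of "_ * block N M a c b" "block N M a c b"] using s
      by (intro cancel[where c = "s powi (2 * int b - int (Suc N))"])
        (auto simp: powi_q algebra_simps simp flip: power_int_add mult.assoc)
    show "?eq (LK N1) a c b \<longleftrightarrow> W (inverse ?q) a c b"
      unfolding unf W_def eq_commute[of "_ * block N M a c b" "block N M a c b"] using s
      by (intro cancel[where c = "s powi (int (Suc N) - 2 * int b)"])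
        (auto simp: powi_q algebra_simps simp flip: power_int_add mult.assoc)
    show "?eq (LKinv N0) a c b \<longleftrightarrow> W (inverse ?q) a c b"
      unfolding unf W_def eq_commute[of "_ * block N M a c b" "block N M a c b"] using s
      by (intro cancel[where c = "s powi (int (Suc N) - 2 * int b)"])
        (auto simp: powi_q algebra_simps simp flip: power_int_add mult.assoc)
    show "?eq (LKinv N1) a c b \<longleftrightarrow> W ?q a c b"
      unfolding unf W_def eq_commute[of "_ * block N M a c b" "block N M a c b"] using s
      by (intro cancel[where c = "s powi (2 * int b - int (Suc N))"])
        (auto simp: powi_q algebra_simps simp flip: power_int_add mult.assoc)
  qed
  show "M * L (LE N1) = T (LE N1) * M \<longleftrightarrow> raising_eqs ?q ?q N (block N M)"
    "M * L (LF N0) = T (LF N0) * M \<longleftrightarrow> raising_eqs ?q (inverse ?q) N (block N M)"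
    "M * L (LF N1) = T (LF N1) * M \<longleftrightarrow> lowering_eqs ?q ?q N (block N M)"
    "M * L (LE N0) = T (LE N0) * M \<longleftrightarrow> lowering_eqs ?q (inverse ?q) N (block N M)"
    "M * L (LK i) = T (LK i) * M \<longleftrightarrow> weight_eqs (if i = N0 then ?q else inverse ?q) N (block N M)"
    "M * L (LKinv i) = T (LKinv i) * M \<longleftrightarrow> weight_eqs (if i = N1 then ?q else inverse ?q) N (block N M)"
    unfolding eq raising_eqs_def lowering_eqs_def weight_eqs_def R_def[symmetric] S_def[symmetric] W_def[symmetric]
    by (cases i; simp add: entries del: mult_Suc mult_Suc_right)+
qed

end

section \<open>Recurrence, closed formula and normalisation\<close>

lemma is_LUq_intertwiner_iff_recurrence:
  assumes j: "2 * j = real N" and not_root: "\<forall>n::nat. n > 0 \<longrightarrow> (s\<^sup>2) ^ n \<noteq> 1" and s: "s \<noteq> 0"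
    and u: "u \<noteq> 0" "u1 = u * s powi (- int N)" "u2 = u * s"
    and M: "M \<in> carrier_mat (2 * Suc N) (Suc (Suc N))"
  shows "is_LUq_intertwiner s j u u1 u2 M \<longleftrightarrow> fusion_recurrence (s\<^sup>2) N (block N M)"
proof -
  let ?q = "s\<^sup>2"
  have q: "?q \<noteq> 0" "?q \<noteq> inverse ?q"
    using s q_neq_inverse[OF not_root] by simp_all
  have u': "u1 \<noteq> 0" "u2 \<noteq> 0" using u s by simp_all
  note gens = generator_eqs[OF j s q(2) u M]
  have "is_LUq_intertwiner s j u u1 u2 M \<longleftrightarrow>
      raising_eqs ?q ?q N (block N M) \<and> raising_eqs ?q (inverse ?q) N (block N M) \<and>
      lowering_eqs ?q ?q N (block N M) \<and> lowering_eqs ?q (inverse ?q) N (block N M) \<and>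
      weight_eqs ?q N (block N M) \<and> weight_eqs (inverse ?q) N (block N M)"
    (is "_ \<longleftrightarrow> ?eqs")
    unfolding is_LUq_intertwiner_iff[OF j s q(2) u(1) u' M]
  proof
    assume *: "\<forall>g. M * loop_mat s (j + 1/2) u g = tensor_mat (loop_mat s (1/2) u1) (loop_mat s j u2) g * M"
    show ?eqs
      using *[rule_format, of "LE N1", unfolded gens] *[rule_format, of "LF N0", unfolded gens]
        *[rule_format, of "LF N1", unfolded gens] *[rule_format, of "LE N0", unfolded gens]
        *[rule_format, of "LK N0", unfolded gens] *[rule_format, of "LK N1", unfolded gens]
      by simp
  next
    assume *: ?eqs
    show "\<forall>g. M * loop_mat s (j + 1/2) u g = tensor_mat (loop_mat s (1/2) u1) (loop_mat s j u2) g * M"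
    proof
      fix g
      show "M * loop_mat s (j + 1/2) u g = tensor_mat (loop_mat s (1/2) u1) (loop_mat s j u2) g * M"
        by (cases g rule: loop_gen_cases; hypsubst; subst gens; use * in simp)
    qed
  qed
  also have "\<dots> \<longleftrightarrow> fusion_recurrence ?q N (block N M)"
    using fusion_recurrence_if_eqs[OF not_root q(1)] fusion_recurrence_raising[OF not_root q(1)]
      fusion_recurrence_lowering[OF not_root q(1)] fusion_recurrence_weight[OF not_root q(1)]
    by blast
  finally show ?thesis .
qed

text \<open>The recurrence along the upper block is of first order, so the start value 1 yields the
  product of the ratios; the lower block follows by one division. The divisors are nonzero since q
  is not a root of unity.\<close>

lemma fusion_entries_iff_recurrence:
  assumes j: "2 * j = real N" and not_root: "\<forall>n::nat. n > 0 \<longrightarrow> (s\<^sup>2) ^ n \<noteq> 1" and s: "s \<noteq> 0"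
  shows "fusion_entries s j M \<longleftrightarrow> block N M 0 0 0 = 1 \<and> fusion_recurrence (s\<^sup>2) N (block N M)"
proof -
  define x where "x = block N M"
  let ?C = "ladder (s\<^sup>2) N" and ?D = "ladder (s\<^sup>2) (Suc N)"
  have j': "2 * (j + 1/2) = real (Suc N)" and N: "nat \<lfloor>2 * j\<rfloor> = N"
    using j by simp_all
  have D0: "?D (Suc b) \<noteq> 0" if "b \<le> N" for b
    using ladder_nonzero[OF not_root, of "Suc b" "Suc N"] s that by simp
  \<comment> \<open>With m = b + 1 the argument j + 3/2 - m is j + 1/2 - b.\<close>
  have D: "B_coeff s (j + 1/2) (j + 3/2 - real (Suc b)) = ?D (Suc b)" for b
    using B_coeff_ladder[OF j', of s b] by (simp add: algebra_simps)
  have qn: "qnum s (real m) = qn (s\<^sup>2) (int m)" for m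
    using qnum_of_int[of s "int m"] by simp
  have top: "entry M (Suc b) (Suc b) = x 0 b b" for b
    by (simp add: entry_def x_def block_def)
  have bot: "entry M (N + 1 + Suc b) (1 + Suc b) = x 1 b (Suc b)" for b
    by (simp add: entry_def x_def block_def)
  have all_Suc: "(\<forall>n\<in>{1..K}. P n) \<longleftrightarrow> (\<forall>b<K. P (Suc b))" for P :: "nat \<Rightarrow> bool" and K
    by (metis Suc_le_eq Suc_le_D atLeastAtMost_iff One_nat_def Suc_le_mono le0)
  have zero: "(\<forall>a\<in>{1..2 * N + 2}. \<forall>b\<in>{1..N + 2}.
        (a, b) \<notin> {(1, 1)} \<union> {(1 + n, 1 + n) | n. n \<in> {1..N}}
                \<union> {(N + 1 + m, 1 + m) | m. m \<in> {1..N + 1}} \<longrightarrow> entry M a b = 0) \<longleftrightarrow>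
      (\<forall>a<2. \<forall>c\<le>N. \<forall>b\<le>Suc N. a + c \<noteq> b \<longrightarrow> x a c b = 0)" (is "?l \<longleftrightarrow> ?r")
  proof
    assume l: ?l
    show ?r
    proof (intro allI impI)
      fix a c b assume abc: "a < (2::nat)" "c \<le> N" "b \<le> Suc N" "a + c \<noteq> b"
      have "a = 0 \<or> a = 1" using abc(1) by auto
      then have "entry M (a * Suc N + c + 1) (b + 1) = 0"
        using abc by (intro l[rule_format]) auto
      then show "x a c b = 0" by (simp add: entry_def x_def block_def)
    qed
  next
    assume r: ?r
    show ?l
    proof (intro ballI impI)
      fix a b assume ab: "a \<in> {1..2 * N + 2}" "b \<in> {1..N + 2}"
        "(a, b) \<notin> {(1, 1)} \<union> {(1 + n, 1 + n) | n. n \<in> {1..N}}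
                \<union> {(N + 1 + m, 1 + m) | m. m \<in> {1..N + 1}}"
      show "entry M a b = 0"
      proof (cases "a \<le> Suc N")
        case True
        have "a \<noteq> b"
        proof
          assume "a = b"
          with True ab(1) have "(a, b) = (1, 1) \<or> (a, b) = (1 + (b - 1), 1 + (b - 1)) \<and> b - 1 \<in> {1..N}"
            by auto
          then show False using ab(3) by blast
        qed
        then have "x 0 (a - 1) (b - 1) = 0"
          using ab True by (intro r[rule_format]) auto
        then show ?thesis by (simp add: entry_def x_def block_def)
      next
        case False
        \<comment> \<open>The admissible entries of the lower block lie at (N + 1 + m, 1 + m);
          equality here would exhibit m = b - 1.\<close>
        have "a - Suc N \<noteq> b - 1"
        proof
          assume "a - Suc N = b - 1"
          with False ab(1,2) have "(a, b) = (N + 1 + (b - 1), 1 + (b - 1))" "b - 1 \<in> {1..N + 1}" by auto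
          then show False using ab(3) by blast
        qed
        then have "x 1 (a - 1 - Suc N) (b - 1) = 0"
          using ab False by (intro r[rule_format]) auto
        moreover have "1 * Suc N + (a - 1 - Suc N) = a - 1" using False by simp
        ultimately show ?thesis by (simp only: entry_def x_def block_def)
      qed
    qed
  qed
  have prod: "(\<Prod>p<n. B_coeff s j (j - real p) / B_coeff s (j + 1/2) (j + 1/2 - real p)) =
      (\<Prod>p<n. ?C (Suc p) / ?D (Suc p))" for n
    by (simp add: B_coeff_ladder[OF j] B_coeff_ladder[OF j'])
  \<comment> \<open>The start value stands on both sides, since it is what links the product to the
    homogeneous recurrence.\<close>
  have up: "x 0 0 0 = 1 \<and> (\<forall>b<N. x 0 (Suc b) (Suc b) = (\<Prod>p<Suc b. ?C (Suc p) / ?D (Suc p))) \<longleftrightarrow>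
      x 0 0 0 = 1 \<and> (\<forall>b<N. ?D (Suc b) * x 0 (Suc b) (Suc b) = ?C (Suc b) * x 0 b b)" (is "?l \<longleftrightarrow> ?r")
  proof
    assume l: ?l
    have "x 0 b b = (\<Prod>p<b. ?C (Suc p) / ?D (Suc p))" if "b \<le> N" for b
      using l that by (cases b) auto
    then show ?r using l D0 by simp
  next
    assume r: ?r
    have "x 0 b b = (\<Prod>p<b. ?C (Suc p) / ?D (Suc p))" if "b \<le> N" for b
      using that
    proof (induction b)
      case (Suc b)
      then show ?case using r[THEN conjunct2, rule_format, of b] D0[of b]
        by (simp add: field_simps)
    qed (use r in simp)
    then show ?l using r by simp
  qed
  have down: "(\<forall>b<N + 1. x 1 b (Suc b) = qn (s\<^sup>2) (int (Suc b)) * (x 0 b b / ?D (Suc b))) \<longleftrightarrow>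
      (\<forall>b\<le>N. ?D (Suc b) * x 1 b (Suc b) = qn (s\<^sup>2) (int (Suc b)) * x 0 b b)"
    using D0 by (auto simp: less_Suc_eq_le eq_divide_eq mult.commute)
  have "fusion_entries s j M \<longleftrightarrow> x 0 0 0 = 1 \<and>
      (\<forall>b<N. x 0 (Suc b) (Suc b) = (\<Prod>p<Suc b. ?C (Suc p) / ?D (Suc p))) \<and>
      (\<forall>b<N + 1. x 1 b (Suc b) = qn (s\<^sup>2) (int (Suc b)) * (x 0 b b / ?D (Suc b))) \<and>
      (\<forall>a<2. \<forall>c\<le>N. \<forall>b\<le>Suc N. a + c \<noteq> b \<longrightarrow> x a c b = 0)"
    unfolding fusion_entries_def Let_def N zero unfolding prod all_Suc bot qn D
    using top by simp
  then show ?thesis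
    using up down unfolding fusion_recurrence_def x_def[symmetric] by blast
qed

lemma fusion_recurrence_scale:
  assumes "M \<in> carrier_mat (2 * Suc N) (Suc (Suc N))" "c \<noteq> 0"
  shows "fusion_recurrence q N (block N (c \<cdot>\<^sub>m M)) \<longleftrightarrow> fusion_recurrence q N (block N M)"
proof -
  have b: "block N (c \<cdot>\<^sub>m M) a d b = c * block N M a d b" if "a < 2" "d \<le> N" "b \<le> Suc N" for a d b
    using assms(1) row_less[OF that(1,2)] that by (simp add: block_def)
  have c: "A * (c * y) = B * (c * z) \<longleftrightarrow> A * y = B * z" for A B y z
    using assms(2) by (metis mult.left_commute mult_left_cancel)
  show ?thesis
    unfolding fusion_recurrence_def
    by (intro conj_cong all_cong1 imp_cong refl) (simp_all only: b c, use assms(2) in simp_all)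
qed

text \<open>A zero in the top left corner would propagate along the recurrence to all entries. So a
  nonzero solution can be normalised there.\<close>

lemma fusion_recurrence_nonzero:
  assumes not_root: "\<forall>n::nat. n > 0 \<longrightarrow> q ^ n \<noteq> 1" "q \<noteq> 0"
    and M: "M \<in> carrier_mat (2 * Suc N) (Suc (Suc N))"
    and F: "fusion_recurrence q N (block N M)" and "M \<noteq> 0\<^sub>m (2 * Suc N) (Suc (Suc N))"
  shows "block N M 0 0 0 \<noteq> 0"
proof
  assume 0: "block N M 0 0 0 = 0"
  have D0: "ladder q (Suc N) (Suc b) \<noteq> 0" if "b \<le> N" for b
    using ladder_nonzero[OF not_root, of "Suc b" "Suc N"] that by simp
  have X: "block N M 0 b b = 0" if "b \<le> N" for b
    using that
  proof (induction b)
    case (Suc b)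
    have "ladder q (Suc N) (Suc b) * block N M 0 (Suc b) (Suc b) = ladder q N (Suc b) * block N M 0 b b"
      using F Suc.prems unfolding fusion_recurrence_def by (metis Suc_le_eq)
    then show ?case using Suc D0[of b] by simp
  qed (rule 0)
  have Y: "block N M 1 b (Suc b) = 0" if "b \<le> N" for b
  proof -
    have "ladder q (Suc N) (Suc b) * block N M 1 b (Suc b) = qn q (int (Suc b)) * block N M 0 b b"
      using F that unfolding fusion_recurrence_def by metis
    then show ?thesis using D0[OF that] X[OF that] by simp
  qed
  have "block N M a c b = 0" if "a < 2" "c \<le> N" "b \<le> Suc N" for a c b
  proof (cases "a + c = b")
    case True
    have "a = 0 \<or> a = 1" using that(1) by auto
    then show ?thesis using True X Y that by auto
  qed (use F that in \<open>auto simp: fusion_recurrence_def\<close>)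
  then have "M = 0\<^sub>m (2 * Suc N) (Suc (Suc N))"
    using M row_less
    by (subst mat_eq_iff_entries[of _ 2 "Suc N" "Suc (Suc N)"])
      (auto simp: block_def less_Suc_eq_le simp del: mult_Suc mult_Suc_right)
  with assms(5) show False by blast
qed

theorem lemma3p1:
  fixes q s u u1 u2 :: complex and j :: real and \<E> \<F> :: "complex mat"
  assumes "q \<noteq> 0" and "\<forall>n::nat. n > 0 \<longrightarrow> q ^ n \<noteq> 1"
    and "s\<^sup>2 = q"
    and "j > 0" and "2 * j \<in> \<nat>"
    and "u \<noteq> 0"
    and "u1 / u2 = qpow s (- j - 1/2)" and "u2 = u * qpow s (1/2)"
    and "\<E> \<in> carrier_mat (spin_dim (1/2) * spin_dim j) (spin_dim (j + 1/2))"
    and "\<F> \<in> carrier_mat (spin_dim (j + 1/2)) (spin_dim (1/2) * spin_dim j)"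
    and "\<F> * \<E> = 1\<^sub>m (spin_dim (j + 1/2))"
  shows "(is_LUq_intertwiner s j u u1 u2 \<E> \<longleftrightarrow> (\<exists>c. c \<noteq> 0 \<and> fusion_entries s j (c \<cdot>\<^sub>m \<E>))) \<and>
    (entry \<E> 1 1 = 1 \<longrightarrow> (is_LUq_intertwiner s j u u1 u2 \<E> \<longleftrightarrow> fusion_entries s j \<E>))"
proof -
  obtain N where j: "2 * j = real N"
    using assms(5) by (auto elim: Nats_cases)
  have j': "2 * (j + 1/2) = real (Suc N)" and h: "2 * (1/2) = real (Suc 0)"
    using j by simp_all
  have dims: "spin_dim (1/2) * spin_dim j = 2 * Suc N" "spin_dim (j + 1/2) = Suc (Suc N)"
    using spin_dim_eq[OF j] spin_dim_eq[OF j'] spin_dim_eq[OF h] by simp_all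
  have M: "\<E> \<in> carrier_mat (2 * Suc N) (Suc (Suc N))"
    using assms(9) unfolding dims .
  have s: "s \<noteq> 0" using assms(1,3) by auto
  have not_root: "\<forall>n::nat. n > 0 \<longrightarrow> (s\<^sup>2) ^ n \<noteq> 1"
    using assms(2,3) by simp
  have u2: "u2 = u * s"
    using assms(8) qpow_of_int[of "1/2" 1 s] by simp
  have "u1 / u2 = s powi (- int N - 1)"
    using assms(7) qpow_of_int[of "- j - 1/2" "- int N - 1" s] j by (simp add: algebra_simps)
  then have u1: "u1 = u * s powi (- int N)"
    using s assms(6) by (simp add: u2 power_int_diff field_simps)
  \<comment> \<open>The pseudo-inverse enters here: it excludes the zero matrix, which intertwines
    but cannot be normalised.\<close>
  have "\<E> \<noteq> 0\<^sub>m (2 * Suc N) (Suc (Suc N))"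
  proof
    assume "\<E> = 0\<^sub>m (2 * Suc N) (Suc (Suc N))"
    then have "\<F> * \<E> = 0\<^sub>m (Suc (Suc N)) (Suc (Suc N))"
      using assms(10) unfolding dims by simp
    then have "(1\<^sub>m (Suc (Suc N)) :: complex mat) $$ (0, 0) = 0"
      using assms(11) unfolding dims by simp
    then show False by simp
  qed
  then have nz: "block N \<E> 0 0 0 \<noteq> 0" if "fusion_recurrence (s\<^sup>2) N (block N \<E>)"
    using fusion_recurrence_nonzero[OF not_root _ M that] s by simp
  have I: "is_LUq_intertwiner s j u u1 u2 \<E> \<longleftrightarrow> fusion_recurrence (s\<^sup>2) N (block N \<E>)"
    by (rule is_LUq_intertwiner_iff_recurrence[OF j not_root s assms(6) u1 u2 M])
  have E: "fusion_entries s j (c \<cdot>\<^sub>m \<E>) \<longleftrightarrow>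
      c * block N \<E> 0 0 0 = 1 \<and> fusion_recurrence (s\<^sup>2) N (block N \<E>)" if "c \<noteq> 0" for c
    using fusion_entries_iff_recurrence[OF j not_root s] fusion_recurrence_scale[OF M that] M
    by (simp add: block_def)
  have "entry \<E> 1 1 = block N \<E> 0 0 0"
    by (simp add: entry_def block_def)
  then have "entry \<E> 1 1 = 1 \<longrightarrow> (is_LUq_intertwiner s j u u1 u2 \<E> \<longleftrightarrow> fusion_entries s j \<E>)"
    using I fusion_entries_iff_recurrence[OF j not_root s] by simp
  moreover have "is_LUq_intertwiner s j u u1 u2 \<E> \<longleftrightarrow> (\<exists>c. c \<noteq> 0 \<and> fusion_entries s j (c \<cdot>\<^sub>m \<E>))"
  proof
    assume "is_LUq_intertwiner s j u u1 u2 \<E>"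
    then have "fusion_recurrence (s\<^sup>2) N (block N \<E>)" using I by simp
    \<comment> \<open>The witness rescales the top left entry to 1.\<close>
    then show "\<exists>c. c \<noteq> 0 \<and> fusion_entries s j (c \<cdot>\<^sub>m \<E>)"
      using E nz by (intro exI[of _ "inverse (block N \<E> 0 0 0)"]) simp
  next
    assume "\<exists>c. c \<noteq> 0 \<and> fusion_entries s j (c \<cdot>\<^sub>m \<E>)"
    then show "is_LUq_intertwiner s j u u1 u2 \<E>" using I E by blast
  qed
  ultimately show ?thesis by blast
qed

end
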